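(* Let $L$ be a Lie ring additively isomorphic to $\mathbb{Z}^n$, and let $*\in\{\leq,\triangleleft\}$. There exist finitely many varieties $U_1^{*},\ldots,U_h^{*}$ defined over $\mathbb{Q}$ and polynomials $W_1^{*}(X,Y),\ldots,W_h^{*}(X,Y)\in\mathbb{Z}[X,Y]$ such that, for almost all (i.e. all but finitely many) primes $p$, $$\zeta_{L(\mathbb{F}_p)}^{*}(s)=\sum_{j=1}^{h}\left|\overline{U_j^{*}}(\mathbb{F}_p)\right|\,W_j^{*}(p,t),\qquad t=p^{-s}.$$
   Context: For a Lie ring $L$ additively isomorphic to $\mathbb{Z}^n$ and a prime $p$, put $L(\mathbb{F}_p)=L\otimes_{\mathbb{Z}}\mathbb{F}_p$, an $n$-dimensional Lie algebra over $\mathbb{F}_p$. Its subalgebra ($*=\leq$) or ideal ($*=\triangleleft$) zeta function is the finite sum $\zeta_{L(\mathbb{F}_p)}^{*}(s)=\sum_{i=0}^{n}a_{p^i}^{*}(L(\mathbb{F}_p))\,t^{i}$, where $t=p^{-s}$ and $a_{p^i}^{*}(L(\mathbb{F}_p))$ is the number of Lie subalgebras (resp. ideals) of $L(\mathbb{F}_p)$ of codimension $i$. For a variety $U$ over $\mathbb{Q}$, $\overline{U}$ denotes its reduction modulo $p$ (with respect to a fixed choice of integral defining equations); it is well defined for all but finitely many $p$. *)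

theory Defs
  imports
    "HOL-Algebra.Free_Abelian_Groups"
    "HOL-Algebra.Generated_Groups"
    "HOL-Number_Theory.Residues"
    "HOL-Analysis.Analysis"
    "Jordan_Normal_Form.Missing_VectorSpace"
begin

section \<open>Lie rings\<close>

text \<open>Lie rings and Lie algebras reuse the records \<open>ring\<close> and \<open>module\<close>: the field \<open>mult\<close> is the Lie
  bracket (neither associative nor commutative in general), and the field \<open>one\<close> has no meaning.\<close>

locale lie_ring = abelian_group L for L (structure) +
  assumes bracket_closed: "\<lbrakk>x \<in> carrier L; y \<in> carrier L\<rbrakk> \<Longrightarrow> x \<otimes> y \<in> carrier L"
    and bracket_add_left: "\<lbrakk>x \<in> carrier L; y \<in> carrier L; z \<in> carrier L\<rbrakk>
      \<Longrightarrow> (x \<oplus> y) \<otimes> z = x \<otimes> z \<oplus> y \<otimes> z"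
    and bracket_add_right: "\<lbrakk>x \<in> carrier L; y \<in> carrier L; z \<in> carrier L\<rbrakk>
      \<Longrightarrow> x \<otimes> (y \<oplus> z) = x \<otimes> y \<oplus> x \<otimes> z"
    and bracket_self: "x \<in> carrier L \<Longrightarrow> x \<otimes> x = \<zero>"
    and jacobi: "\<lbrakk>x \<in> carrier L; y \<in> carrier L; z \<in> carrier L\<rbrakk>
      \<Longrightarrow> x \<otimes> (y \<otimes> z) \<oplus> y \<otimes> (z \<otimes> x) \<oplus> z \<otimes> (x \<otimes> y) = \<zero>"


section \<open>The base change of a Lie ring along \<open>\<int> \<rightarrow> R\<close>\<close>

text \<open>The tensor product of \<open>L\<close> and \<open>R\<close> over the integers is the free abelian group on
  \<open>carrier L \<times> carrier R\<close> modulo the subgroup generated by the biadditivity relations; the generator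
  \<open>frag_of (x, a)\<close> represents the pure tensor of \<open>x\<close> and \<open>a\<close>.  (Balancedness over the integers
  follows from biadditivity.)\<close>

definition tensor_free :: "('a, 'm) ring_scheme \<Rightarrow> ('r, 'k) ring_scheme \<Rightarrow> ('a \<times> 'r \<Rightarrow>\<^sub>0 int) monoid"
  where "tensor_free L R = free_Abelian_group (carrier L \<times> carrier R)"

definition tensor_rel :: "('a, 'm) ring_scheme \<Rightarrow> ('r, 'k) ring_scheme \<Rightarrow> ('a \<times> 'r \<Rightarrow>\<^sub>0 int) set"
  where "tensor_rel L R = generate (tensor_free L R)
     ({frag_of (x \<oplus>\<^bsub>L\<^esub> y, a) - frag_of (x, a) - frag_of (y, a) | x y a.
         x \<in> carrier L \<and> y \<in> carrier L \<and> a \<in> carrier R} \<union>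
      {frag_of (x, a \<oplus>\<^bsub>R\<^esub> b) - frag_of (x, a) - frag_of (x, b) | x a b.
         x \<in> carrier L \<and> a \<in> carrier R \<and> b \<in> carrier R})"

text \<open>On generators the bracket is \<open>[x \<otimes> a, y \<otimes> b] = [x, y] \<otimes> ab\<close> and the scalar multiplication is
  \<open>r \<cdot> (x \<otimes> a) = x \<otimes> ra\<close>.\<close>

definition tensor_bracket ::
  "('a, 'm) ring_scheme \<Rightarrow> ('r, 'k) ring_scheme \<Rightarrow>
   ('a \<times> 'r \<Rightarrow>\<^sub>0 int) \<Rightarrow> ('a \<times> 'r \<Rightarrow>\<^sub>0 int) \<Rightarrow> ('a \<times> 'r \<Rightarrow>\<^sub>0 int)"
  where "tensor_bracket L R f g =
    frag_extend (\<lambda>(x, a). frag_extend (\<lambda>(y, b). frag_of (x \<otimes>\<^bsub>L\<^esub> y, a \<otimes>\<^bsub>R\<^esub> b)) g) f"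

definition tensor_scale ::
  "('r, 'k) ring_scheme \<Rightarrow> 'r \<Rightarrow> ('a \<times> 'r \<Rightarrow>\<^sub>0 int) \<Rightarrow> ('a \<times> 'r \<Rightarrow>\<^sub>0 int)"
  where "tensor_scale R r = frag_extend (\<lambda>(x, a). frag_of (x, r \<otimes>\<^bsub>R\<^esub> a))"

text \<open>As for \<open>rcoset_mult\<close>, operations on cosets are unions over all representatives; every coset in
  such a union is the same one.\<close>

definition base_change ::
  "('a, 'm) ring_scheme \<Rightarrow> ('r, 'k) ring_scheme \<Rightarrow> ('r, ('a \<times> 'r \<Rightarrow>\<^sub>0 int) set) module"
  where "base_change L R =
    \<lparr>carrier = rcosets\<^bsub>tensor_free L R\<^esub> (tensor_rel L R),
     monoid.mult = (\<lambda>A B. \<Union>f\<in>A. \<Union>g\<in>B. tensor_rel L R #>\<^bsub>tensor_free L R\<^esub> tensor_bracket L R f g),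
     monoid.one = undefined,
     ring.zero = tensor_rel L R,
     ring.add = set_mult (tensor_free L R),
     module.smult = (\<lambda>r A. \<Union>f\<in>A. tensor_rel L R #>\<^bsub>tensor_free L R\<^esub> tensor_scale R r f)\<rparr>"

abbreviation prime_field :: "nat \<Rightarrow> int ring"
  where "prime_field p \<equiv> residue_ring (int p)"


section \<open>Subalgebra and ideal zeta functions\<close>

datatype zeta_kind = Subalgebras | Ideals

definition lie_subalgebra :: "('k, 'c) ring_scheme \<Rightarrow> ('k, 'b, 'd) module_scheme \<Rightarrow> 'b set \<Rightarrow> bool"
  where "lie_subalgebra K A H \<longleftrightarrow>
    VectorSpace.subspace K H A \<and> (\<forall>x\<in>H. \<forall>y\<in>H. x \<otimes>\<^bsub>A\<^esub> y \<in> H)"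

definition lie_ideal :: "('k, 'c) ring_scheme \<Rightarrow> ('k, 'b, 'd) module_scheme \<Rightarrow> 'b set \<Rightarrow> bool"
  where "lie_ideal K A H \<longleftrightarrow>
    VectorSpace.subspace K H A \<and> (\<forall>x\<in>carrier A. \<forall>y\<in>H. x \<otimes>\<^bsub>A\<^esub> y \<in> H)"

fun counted_by :: "zeta_kind \<Rightarrow> ('k, 'c) ring_scheme \<Rightarrow> ('k, 'b, 'd) module_scheme \<Rightarrow> 'b set \<Rightarrow> bool"
  where
    "counted_by Subalgebras = lie_subalgebra"
  | "counted_by Ideals = lie_ideal"

text \<open>Meaningful only if \<open>A\<close> is finite-dimensional: \<open>dim\<close> is arbitrary otherwise.\<close>

definition has_codim :: "('k, 'c) ring_scheme \<Rightarrow> ('k, 'b, 'd) module_scheme \<Rightarrow> 'b set \<Rightarrow> nat \<Rightarrow> bool"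
  where "has_codim K A H i \<longleftrightarrow>
    vectorspace.dim K A = vectorspace.dim K (A\<lparr>carrier := H\<rparr>) + i"

definition codim_count :: "zeta_kind \<Rightarrow> ('k, 'c) ring_scheme \<Rightarrow> ('k, 'b, 'd) module_scheme \<Rightarrow> nat \<Rightarrow> nat"
  where "codim_count star K A i = card {H. counted_by star K A H \<and> has_codim K A H i}"

definition lie_zeta :: "zeta_kind \<Rightarrow> ('a, 'm) ring_scheme \<Rightarrow> nat \<Rightarrow> nat \<Rightarrow> complex \<Rightarrow> complex"
  where "lie_zeta star L n p s =
    (\<Sum>i=0..n. of_nat (codim_count star (prime_field p) (base_change L (prime_field p)) i)
       * (of_nat p powr (- s)) ^ i)"


section \<open>Varieties over the rationals with integral defining equations\<close>

text \<open>A multivariate polynomial over the integers is a finitely supported map from monomials to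
  coefficients, a monomial being a finitely supported exponent vector.  Its value in a ring \<open>K\<close>
  uses the images of the integer coefficients in \<open>K\<close>, so over a prime field it is the value of the
  reduced polynomial.\<close>

type_synonym int_mpoly = "(nat \<Rightarrow>\<^sub>0 nat) \<Rightarrow>\<^sub>0 int"

definition eval_mpoly :: "('k, 'c) ring_scheme \<Rightarrow> int_mpoly \<Rightarrow> (nat \<Rightarrow> 'k) \<Rightarrow> 'k"
  where "eval_mpoly K f x =
    (\<Oplus>\<^bsub>K\<^esub>m\<in>Poly_Mapping.keys f. [Poly_Mapping.lookup f m] \<cdot>\<^bsub>K\<^esub>
       (\<Otimes>\<^bsub>K\<^esub>i\<in>Poly_Mapping.keys m. x i [^]\<^bsub>K\<^esub> Poly_Mapping.lookup m i))"

definition homogeneous_in :: "nat \<Rightarrow> int_mpoly \<Rightarrow> bool"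
  where "homogeneous_in N f \<longleftrightarrow>
    (\<forall>m\<in>Poly_Mapping.keys f. Poly_Mapping.keys m \<subseteq> {..N}) \<and>
    (\<exists>d. \<forall>m\<in>Poly_Mapping.keys f. (\<Sum>i\<in>Poly_Mapping.keys m. Poly_Mapping.lookup m i) = d)"

text \<open>A quasi-projective variety over the rationals (not assumed irreducible), together with a
  choice of integral equations defining it: the locus in projective \<open>N\<close>-space, with coordinates
  indexed by \<open>0, \<dots>, N\<close>, where all polynomials in \<open>vanishing\<close> are zero and at least one polynomial in
  \<open>nonvanishing\<close> is nonzero.  Clearing denominators, every quasi-projective variety over the
  rationals has this form; affine and projective varieties are special cases.\<close>

record variety =
  ambient_dim :: nat
  vanishing :: "int_mpoly set"
  nonvanishing :: "int_mpoly set"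

definition is_variety :: "variety \<Rightarrow> bool"
  where "is_variety U \<longleftrightarrow>
    finite (vanishing U) \<and> finite (nonvanishing U) \<and>
    (\<forall>f \<in> vanishing U \<union> nonvanishing U. homogeneous_in (ambient_dim U) f)"

definition nonzero_vectors :: "nat \<Rightarrow> ('k, 'c) ring_scheme \<Rightarrow> (nat \<Rightarrow> 'k) set"
  where "nonzero_vectors N K = ({..N} \<rightarrow>\<^sub>E carrier K) - {\<lambda>i\<in>{..N}. \<zero>\<^bsub>K\<^esub>}"

definition projective_space :: "nat \<Rightarrow> ('k, 'c) ring_scheme \<Rightarrow> (nat \<Rightarrow> 'k) set set"
  where "projective_space N K =
    nonzero_vectors N K //
      {(x, y). x \<in> nonzero_vectors N K \<and> y \<in> nonzero_vectors N K \<and>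
               (\<exists>c\<in>carrier K. y = (\<lambda>i\<in>{..N}. c \<otimes>\<^bsub>K\<^esub> x i))}"

text \<open>For \<open>K = prime_field p\<close> these are the points over the field with \<open>p\<close> elements of the reduction of
  \<open>U\<close> modulo \<open>p\<close>.\<close>

definition variety_points :: "('k, 'c) ring_scheme \<Rightarrow> variety \<Rightarrow> (nat \<Rightarrow> 'k) set set"
  where "variety_points K U =
    {P \<in> projective_space (ambient_dim U) K. \<forall>x\<in>P.
       (\<forall>f\<in>vanishing U. eval_mpoly K f x = \<zero>\<^bsub>K\<^esub>) \<and>
       (\<exists>g\<in>nonvanishing U. eval_mpoly K g x \<noteq> \<zero>\<^bsub>K\<^esub>)}"


section \<open>Integer polynomials in two variables\<close>

text \<open>An element of \<open>int poly poly\<close> is read as a polynomial in \<open>Y\<close> with coefficients in \<open>\<int>[X]\<close>.\<close>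

definition eval_XY :: "int poly poly \<Rightarrow> complex \<Rightarrow> complex \<Rightarrow> complex"
  where "eval_XY W x y = poly (map_poly (\<lambda>c. poly (map_poly of_int c) x) W) y"

end

theory Submission
  imports Defs
begin

text \<open>A basis of \<open>L\<close> identifies \<open>L(F\<^sub>p)\<close> with \<open>F\<^sub>p\<^sup>n\<close>, with bracket given by the reductions of
  integral structure constants.  A subspace is the row space of a unique reduced echelon matrix \<open>M\<close>,
  and for a fixed set \<open>S\<close> of pivots these matrices form an affine space.  Written as an \<open>n \<times> n\<close> matrix
  with zero rows outside \<open>S\<close>, \<open>M\<close> is idempotent, so that a vector \<open>v\<close> lies in the row space if and only
  if \<open>v M = v\<close>; being a subalgebra or an ideal is therefore given by polynomial equations in the
  entries of \<open>M\<close>, with integral coefficients independent of \<open>p\<close>.  Thus there is one variety for each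
  \<open>S \<subseteq> {0, \<dots>, n - 1}\<close>, with the polynomial \<open>Y\<close> to the power \<open>n - |S|\<close>, and no prime is exceptional.\<close>

section \<open>Linear functionals on free abelian groups\<close>

text \<open>Varieties are loci in projective space, so the affine space of echelon matrices is
  placed in the chart where coordinate 0 is nonzero: the equations are homogenised with that
  coordinate, and \<open>nonvanishing\<close> consists of it alone. Normalising it to 1 turns
  projective points into solutions of congruences modulo \<open>p\<close>. Dimension is never
  followed through the change of coordinates. A subspace of dimension \<open>d\<close> over the
  field with \<open>p\<close> elements has \<open>p ^ d\<close> elements, so a given codimension
  becomes a given cardinality on both sides. The main obstacle is that the base change is a quotient
  of a huge free abelian group. That its relations leave at most one class for each vector of
  residues is shown by rewriting every element to a normal form; that they leave at least one comes
  from coordinate functionals that kill the relations modulo \<open>p\<close>.\<close>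

lemmas cong_iff_mod_eq = unique_euclidean_semiring_class.cong_def

text \<open>The additive extension of \<open>w\<close> from generators to finitely supported integer
  combinations. With monomial values for \<open>w\<close> it evaluates polynomials, with coordinates
  of pure tensors it yields coordinates on the free abelian group behind the base change.\<close>

definition frag_eval :: "('b \<Rightarrow> int) \<Rightarrow> ('b \<Rightarrow>\<^sub>0 int) \<Rightarrow> int"
  where "frag_eval w f = (\<Sum>m\<in>Poly_Mapping.keys f. Poly_Mapping.lookup f m * w m)"

lemma frag_eval_superset:
  assumes "finite A" "Poly_Mapping.keys f \<subseteq> A"
  shows "frag_eval w f = (\<Sum>m\<in>A. Poly_Mapping.lookup f m * w m)"
  unfolding frag_eval_def
  by (rule sum.mono_neutral_left) (use assms in \<open>auto simp: in_keys_iff\<close>)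

lemma frag_eval_0 [simp]: "frag_eval w 0 = 0"
  by (simp add: frag_eval_def)

lemma frag_eval_single [simp]: "frag_eval w (Poly_Mapping.single m c) = c * w m"
  by (simp add: frag_eval_def)

lemma frag_eval_add: "frag_eval w (f + g) = frag_eval w f + frag_eval w g"
proof -
  let ?A = "Poly_Mapping.keys f \<union> Poly_Mapping.keys g"
  have "Poly_Mapping.keys (f + g) \<subseteq> ?A" by (rule Poly_Mapping.keys_add)
  then show ?thesis
    by (simp add: frag_eval_superset[of ?A] lookup_add distrib_right sum.distrib)
qed

lemma frag_eval_minus: "frag_eval w (- f) = - frag_eval w f"
  using frag_eval_add[of w f "- f"] by simp

lemma frag_eval_diff: "frag_eval w (f - g) = frag_eval w f - frag_eval w g"
  using frag_eval_add[of w f "- g"] by (simp add: frag_eval_minus)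

lemma frag_eval_cmul: "frag_eval w (frag_cmul c f) = c * frag_eval w f"
  by (simp add: frag_eval_superset[of "Poly_Mapping.keys f"] keys_cmul sum_distrib_left mult.assoc)

lemma frag_eval_sum: "frag_eval w (\<Sum>i\<in>I. f i) = (\<Sum>i\<in>I. frag_eval w (f i))"
  by (induction I rule: infinite_finite_induct) (simp_all add: frag_eval_add)

text \<open>Both sides are additive in \<open>f\<close> and agree on generators. This turns the
  nested extensions in \<open>tensor_bracket\<close> into iterated evaluations.\<close>

lemma frag_eval_frag_extend:
  "frag_eval w (frag_extend h f) = frag_eval (\<lambda>m. frag_eval w (h m)) f"
  by (simp add: frag_extend_def frag_eval_sum frag_eval_cmul frag_eval_def[of "\<lambda>m. frag_eval w (h m)"])

lemma frag_eval_cong: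
  assumes "\<And>m. m \<in> Poly_Mapping.keys f \<Longrightarrow> [w m = w' m] (mod k)"
  shows "[frag_eval w f = frag_eval w' f] (mod k)"
  unfolding frag_eval_def by (intro cong_sum cong_mult assms cong_refl)

section \<open>Integer polynomials and affine loci\<close>

abbreviation monomial_value :: "(nat \<Rightarrow> int) \<Rightarrow> (nat \<Rightarrow>\<^sub>0 nat) \<Rightarrow> int"
  where "monomial_value x m \<equiv> \<Prod>i\<in>Poly_Mapping.keys m. x i ^ Poly_Mapping.lookup m i"

context residues
begin

lemma nat_pow_eq: "x [^] (k::nat) = x ^ k mod m"
proof (induction k)
  case 0
  then show ?case using m_gt_one by (simp add: res_one_eq)
next
  case (Suc k)
  then show ?case by (simp add: res_mult_eq mod_simps mult.commute)
qed

lemma int_multiple_eq: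
  fixes k :: int
  assumes "x \<in> carrier R"
  shows "[k] \<cdot> x = k * x mod m"
proof -
  interpret abelian_group R by (rule abelian_group)
  have nat: "[j] \<cdot> x = int j * x mod m" for j :: nat
    using assms by (induction j) (simp_all add: res_zero_eq res_add_eq mod_simps algebra_simps)
  show ?thesis
  proof (cases "k \<ge> 0")
    case True
    then obtain j where "k = int j" by (metis nonneg_int_cases)
    then show ?thesis using nat[of j] add_pow_int_ge[of "int j" R x] by simp
  next
    case False
    then obtain j where k: "k = - int j" by (metis int_cases2 le_minus_iff minus_equation_iff of_nat_0_le_iff linear)
    have "[k] \<cdot> x = \<ominus> ([j] \<cdot> x)"
      using add_pow_int_lt[of k R x] False k by simp
    then show ?thesis by (simp add: nat res_neg_eq k mod_simps)
  qed
qed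

text \<open>Reduction modulo \<open>m\<close> is a ring homomorphism, so it commutes with
  evaluation. From here on polynomials are evaluated over the integers and only congruences
  matter.\<close>

lemma eval_mpoly_eq: "eval_mpoly R f x = frag_eval (monomial_value x) f mod m"
proof -
  have "(\<Otimes>i\<in>Poly_Mapping.keys q. x i [^] Poly_Mapping.lookup q i) = monomial_value x q mod m" for q
    using prod_cong[of "Poly_Mapping.keys q"] by (simp add: nat_pow_eq)
  then have "[Poly_Mapping.lookup f q] \<cdot> (\<Otimes>i\<in>Poly_Mapping.keys q. x i [^] Poly_Mapping.lookup q i)
      = Poly_Mapping.lookup f q * monomial_value x q mod m" for q
    by (simp add: int_multiple_eq mod_simps)
  then show ?thesis
    by (simp add: eval_mpoly_def frag_eval_def sum_cong)
qed

end

section \<open>Monomials and homogeneous polynomials under scaling\<close>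

lemma monomial_value_superset:
  assumes "finite A" "Poly_Mapping.keys m \<subseteq> A"
  shows "monomial_value x m = (\<Prod>i\<in>A. x i ^ Poly_Mapping.lookup m i)"
  by (rule prod.mono_neutral_left) (use assms in \<open>auto simp: in_keys_iff\<close>)

lemma monomial_value_add: "monomial_value x (m + m') = monomial_value x m * monomial_value x m'"
proof -
  let ?A = "Poly_Mapping.keys m \<union> Poly_Mapping.keys m'"
  have "Poly_Mapping.keys (m + m') \<subseteq> ?A" by (rule Poly_Mapping.keys_add)
  then have "monomial_value x (m + m') = (\<Prod>i\<in>?A. x i ^ Poly_Mapping.lookup (m + m') i)"
    by (intro monomial_value_superset) auto
  also have "\<dots> = (\<Prod>i\<in>?A. x i ^ Poly_Mapping.lookup m i) * (\<Prod>i\<in>?A. x i ^ Poly_Mapping.lookup m' i)"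
    by (simp add: lookup_add power_add prod.distrib)
  also have "\<dots> = monomial_value x m * monomial_value x m'"
    using monomial_value_superset[of ?A m x] monomial_value_superset[of ?A m' x] by simp
  finally show ?thesis .
qed

lemma monomial_value_scale:
  "monomial_value (\<lambda>i. c * x i) m
    = c ^ (\<Sum>i\<in>Poly_Mapping.keys m. Poly_Mapping.lookup m i) * monomial_value x m"
  by (simp add: power_mult_distrib prod.distrib power_sum)

text \<open>One exponent serves all scalars and points, so that vanishing depends only on the
  projective point.\<close>

lemma homogeneous_in_scale:
  assumes "homogeneous_in N f"
  obtains d where "\<And>c x. frag_eval (monomial_value (\<lambda>i. c * x i)) f = c ^ d * frag_eval (monomial_value x) f"
proof -
  from assms obtain d
    where d: "\<And>m. m \<in> Poly_Mapping.keys f \<Longrightarrow> (\<Sum>i\<in>Poly_Mapping.keys m. Poly_Mapping.lookup m i) = d"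
    unfolding homogeneous_in_def by auto
  have "frag_eval (monomial_value (\<lambda>i. c * x i)) f = c ^ d * frag_eval (monomial_value x) f" for c x
    unfolding frag_eval_def sum_distrib_left
    by (rule sum.cong) (simp_all add: monomial_value_scale d mult_ac)
  with that show thesis by blast
qed

text \<open>Variables are listed with multiplicity, so the degree is the length of the list, and a
  term is homogenised by adding 0 to the list.\<close>

definition term_poly :: "int \<Rightarrow> nat list \<Rightarrow> int_mpoly"
  where "term_poly c vs = Poly_Mapping.single (sum_list (map (\<lambda>v. Poly_Mapping.single v 1) vs)) c"

lemma eval_term_poly:
  "frag_eval (monomial_value x) (term_poly c vs) = c * prod_list (map x vs)"
proof -
  have "monomial_value x (sum_list (map (\<lambda>v. Poly_Mapping.single v 1) vs)) = prod_list (map x vs)"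
    by (induction vs) (simp_all add: monomial_value_add)
  then show ?thesis by (simp add: term_poly_def)
qed

text \<open>Naming the degree makes homogeneity stable under sums; in \<open>homogeneous_in\<close>
  the degree is existentially quantified, and two summands could have different ones.\<close>

definition homogeneous_degree :: "nat \<Rightarrow> nat \<Rightarrow> int_mpoly \<Rightarrow> bool"
  where "homogeneous_degree N d f \<longleftrightarrow> (\<forall>m\<in>Poly_Mapping.keys f. Poly_Mapping.keys m \<subseteq> {..N} \<and>
    (\<Sum>i\<in>Poly_Mapping.keys m. Poly_Mapping.lookup m i) = d)"

lemma homogeneous_degree_imp: "homogeneous_degree N d f \<Longrightarrow> homogeneous_in N f"
  by (auto simp: homogeneous_degree_def homogeneous_in_def)

lemma homogeneous_degree_add:
  assumes "homogeneous_degree N d f" "homogeneous_degree N d g"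
  shows "homogeneous_degree N d (f + g)"
  using assms Poly_Mapping.keys_add[of f g] unfolding homogeneous_degree_def by blast

lemma homogeneous_degree_sum:
  assumes "\<And>i. i \<in> I \<Longrightarrow> homogeneous_degree N d (f i)"
  shows "homogeneous_degree N d (\<Sum>i\<in>I. f i)"
  using assms
  by (induction I rule: infinite_finite_induct)
    (simp_all add: homogeneous_degree_add, simp_all add: homogeneous_degree_def)

lemma homogeneous_degree_term_poly:
  assumes "set vs \<subseteq> {..N}"
  shows "homogeneous_degree N (length vs) (term_poly c vs)"
proof -
  let ?m = "\<lambda>vs. sum_list (map (\<lambda>v. Poly_Mapping.single v (1::nat)) vs)"
  have keys: "Poly_Mapping.keys (?m vs) \<subseteq> set vs" for vs
  proof (induction vs)
    case (Cons v vs)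
    then show ?case using Poly_Mapping.keys_add[of "Poly_Mapping.single v (1::nat)" "?m vs"] by auto
  qed simp
  have sum: "(\<Sum>i\<in>Poly_Mapping.keys m. Poly_Mapping.lookup m i) = (\<Sum>i\<in>A. Poly_Mapping.lookup m i)"
    if "finite A" "Poly_Mapping.keys m \<subseteq> A" for m :: "nat \<Rightarrow>\<^sub>0 nat" and A
    by (rule sum.mono_neutral_left) (use that in \<open>auto simp: in_keys_iff\<close>)
  \<comment> \<open>A fixed index set \<open>A\<close> replaces the support, which changes along the
    list.\<close>
  have "(\<Sum>i\<in>A. Poly_Mapping.lookup (?m vs) i) = length vs" if "finite A" "set vs \<subseteq> A" for A
    using that
  proof (induction vs)
    case (Cons v vs)
    have "(\<Sum>i\<in>A. Poly_Mapping.lookup (Poly_Mapping.single v (1::nat)) i) = 1"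
      using Cons.prems by (simp add: lookup_single when_def)
    with Cons show ?case by (simp add: lookup_add sum.distrib)
  qed simp
  then have "(\<Sum>i\<in>Poly_Mapping.keys (?m vs). Poly_Mapping.lookup (?m vs) i) = length vs"
    using keys[of vs] sum[of "set vs" "?m vs"] by simp
  with keys[of vs] assms show ?thesis
    by (auto simp: homogeneous_degree_def term_poly_def)
qed

section \<open>Projective points of a chart as normalised solutions of congruences\<close>

definition affine_points :: "int \<Rightarrow> variety \<Rightarrow> (nat \<Rightarrow> int) set"
  where "affine_points p U = {x \<in> {..ambient_dim U} \<rightarrow>\<^sub>E {0..<p}. x 0 = 1 \<and>
    (\<forall>f\<in>vanishing U. [frag_eval (monomial_value x) f = 0] (mod p))}"

text \<open>A class of vectors with invertible coordinate 0 contains exactly one vector whose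
  coordinate 0 is 1, and homogeneity makes the equations hold for all representatives or for none.
  Primality of \<open>p\<close> supplies the inverses.\<close>

lemma card_variety_points_affine:
  fixes p :: int
  assumes p: "prime p" and U: "is_variety U" and non: "nonvanishing U = {term_poly 1 [0]}"
  shows "card (variety_points (residue_ring p) U) = card (affine_points p U)"
proof -
  have p1: "p > 1" using p by (simp add: prime_gt_1_int)
  interpret residues p "residue_ring p" by (simp_all add: residues_def p1)
  let ?K = "residue_ring p" and ?N = "ambient_dim U"
  let ?V = "nonzero_vectors ?N ?K"
  define rel where "rel = {(x, y). x \<in> ?V \<and> y \<in> ?V \<and>
      (\<exists>c\<in>carrier ?K. y = (\<lambda>i\<in>{..?N}. c \<otimes>\<^bsub>?K\<^esub> x i))}"
  have carr: "carrier ?K = {0..<p}" by (auto simp: res_carrier_eq)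
  have V_iff: "x \<in> ?V \<longleftrightarrow> x \<in> {..?N} \<rightarrow>\<^sub>E {0..<p} \<and> (\<exists>i\<le>?N. x i \<noteq> 0)" for x
  proof -
    have "x = (\<lambda>i\<in>{..?N}. 0) \<longleftrightarrow> (\<forall>i\<le>?N. x i = 0)" if "x \<in> {..?N} \<rightarrow>\<^sub>E {0..<p}"
      using that by (auto simp: fun_eq_iff PiE_def extensional_def)
    then show ?thesis by (auto simp: nonzero_vectors_def carr res_zero_eq)
  qed
  have scale: "(\<lambda>i\<in>{..?N}. c \<otimes>\<^bsub>?K\<^esub> x i) = (\<lambda>i\<in>{..?N}. (c * x i) mod p)" for c x
    by (simp add: res_mult_eq)
  have relD: "\<exists>c. 0 < c \<and> c < p \<and> y = (\<lambda>i\<in>{..?N}. (c * x i) mod p)" if xy: "(x, y) \<in> rel" for x y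
  proof -
    from xy obtain c where c: "c \<in> {0..<p}" "y = (\<lambda>i\<in>{..?N}. (c * x i) mod p)" and "y \<in> ?V"
      by (auto simp: rel_def carr scale)
    \<comment> \<open>The relation admits the scalar 0, but that would make \<open>y\<close> the
      zero vector.\<close>
    have "c \<noteq> 0" using c(2) \<open>y \<in> ?V\<close> by (auto simp: V_iff)
    with c show ?thesis by (intro exI[of _ c]) auto
  qed
  have relI: "(x, \<lambda>i\<in>{..?N}. (c * x i) mod p) \<in> rel" if x: "x \<in> ?V" and c: "\<not> p dvd c" for x c
  proof -
    from x obtain i where i: "i \<le> ?N" "x i \<noteq> 0" and xi: "x \<in> {..?N} \<rightarrow>\<^sub>E {0..<p}" by (auto simp: V_iff)
    have "x i \<in> {0..<p}" using xi i by (auto simp: PiE_iff)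
    then have "\<not> p dvd x i" using i(2) by (auto dest: zdvd_imp_le)
    then have "c * x i mod p \<noteq> 0" using p c by (simp add: prime_dvd_mult_iff flip: dvd_eq_mod_eq_0)
    then have "(\<lambda>i\<in>{..?N}. (c * x i) mod p) \<in> ?V"
      using i p1 by (auto simp: V_iff)
    moreover have "(\<lambda>i\<in>{..?N}. (c * x i) mod p) = (\<lambda>i\<in>{..?N}. (c mod p) \<otimes>\<^bsub>?K\<^esub> x i)"
      by (simp add: res_mult_eq mod_simps)
    moreover have "c mod p \<in> carrier ?K" using p1 by (simp add: carr)
    ultimately show ?thesis using x by (auto simp: rel_def)
  qed
  have inverse: "\<exists>d. [d * c = 1] (mod p)" if "\<not> p dvd c" for c
    using that p cong_solve_coprime_int[of c p] by (metis coprime_commute mult.commute prime_imp_coprime)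
  have norm: "x = (\<lambda>i\<in>{..?N}. x i mod p)" if "x \<in> {..?N} \<rightarrow>\<^sub>E {0..<p}" for x
    using that by (fastforce simp: fun_eq_iff PiE_iff extensional_def)
  have equiv: "equiv ?V rel"
  proof (rule equivI)
    show "rel \<subseteq> ?V \<times> ?V" by (auto simp: rel_def)
    show "refl_on ?V rel"
    proof (rule refl_onI)
      fix x assume x: "x \<in> ?V"
      then have "x = (\<lambda>i\<in>{..?N}. (1 * x i) mod p)" using norm[of x] by (simp add: V_iff)
      with relI[OF x, of 1] p1 show "(x, x) \<in> rel" by simp
    qed
    show "sym rel"
    proof (rule symI)
      fix x y assume xy: "(x, y) \<in> rel"
      then obtain c where c: "0 < c" "c < p" "y = (\<lambda>i\<in>{..?N}. (c * x i) mod p)" using relD by blast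
      have x: "x \<in> ?V" and y: "y \<in> ?V" using xy by (auto simp: rel_def)
      obtain d where d: "[d * c = 1] (mod p)" using inverse c by (metis zdvd_not_zless)
      have "[d * ((c * x i) mod p) = x i] (mod p)" for i
        using cong_mult[OF d cong_refl[of "x i"]] by (simp add: cong_iff_mod_eq mod_simps mult.assoc)
      then have "x = (\<lambda>i\<in>{..?N}. (d * y i) mod p)"
        using norm[of x] x by (simp add: V_iff c(3) cong_iff_mod_eq cong: restrict_cong)
      moreover have "\<not> p dvd d"
        using d p1 by (auto simp: cong_iff_mod_eq dvd_def mult.assoc)
      ultimately show "(y, x) \<in> rel" using relI[OF y, of d] by simp
    qed
    show "trans rel"
    proof (rule transI)
      fix x y z assume xy: "(x, y) \<in> rel" and yz: "(y, z) \<in> rel"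
      obtain c where c: "0 < c" "c < p" "y = (\<lambda>i\<in>{..?N}. (c * x i) mod p)" using relD xy by blast
      obtain d where d: "0 < d" "d < p" "z = (\<lambda>i\<in>{..?N}. (d * y i) mod p)" using relD yz by blast
      have "z = (\<lambda>i\<in>{..?N}. ((d * c) * x i) mod p)"
        by (simp add: c(3) d(3) mod_simps mult.assoc cong: restrict_cong)
      moreover have "\<not> p dvd d * c"
        using c d p by (auto simp: prime_dvd_mult_iff dest: zdvd_imp_le)
      ultimately show "(x, z) \<in> rel" using relI[of x "d * c"] xy by (auto simp: rel_def)
    qed
  qed
  define good where "good x \<longleftrightarrow> x 0 mod p \<noteq> 0 \<and>
      (\<forall>f\<in>vanishing U. [frag_eval (monomial_value x) f = 0] (mod p))" for x
  have pts: "variety_points ?K U = {P \<in> ?V // rel. \<forall>x\<in>P. good x}"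
    by (auto simp: variety_points_def projective_space_def rel_def good_def non eval_mpoly_eq
        eval_term_poly cong_iff_mod_eq res_zero_eq)
  \<comment> \<open>The equations involve only coordinates up to \<open>?N\<close>, so they do not
    see the value \<open>undefined\<close> that restriction puts elsewhere.\<close>
  have value_restrict: "frag_eval (monomial_value (\<lambda>i\<in>{..?N}. y i mod p)) f mod p
      = frag_eval (monomial_value y) f mod p" if "f \<in> vanishing U" for f y
  proof -
    have "Poly_Mapping.keys m \<subseteq> {..?N}" if "m \<in> Poly_Mapping.keys f" for m
      using U \<open>f \<in> vanishing U\<close> that by (auto simp: is_variety_def homogeneous_in_def)
    then have "[frag_eval (monomial_value (\<lambda>i\<in>{..?N}. y i mod p)) f = frag_eval (monomial_value y) f] (mod p)"
      by (intro frag_eval_cong cong_prod cong_pow) (auto simp: cong_iff_mod_eq)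
    then show ?thesis by (simp add: cong_iff_mod_eq)
  qed
  \<comment> \<open>\<open>variety_points\<close> tests every representative of a class; by this
    invariance one is enough.\<close>
  have good_rel: "good y" if "good x" and xy: "(x, y) \<in> rel" for x y
  proof -
    obtain c where c: "0 < c" "c < p" "y = (\<lambda>i\<in>{..?N}. (c * x i) mod p)" using relD xy by blast
    have "\<not> p dvd c" using c by (auto dest: zdvd_imp_le)
    then have "y 0 mod p \<noteq> 0"
      using \<open>good x\<close> p by (simp add: c(3) good_def prime_dvd_mult_iff flip: dvd_eq_mod_eq_0)
    moreover have "[frag_eval (monomial_value y) f = 0] (mod p)" if f: "f \<in> vanishing U" for f
    proof -
      have "homogeneous_in ?N f" using U f by (auto simp: is_variety_def)
      then obtain d where d: "frag_eval (monomial_value (\<lambda>i. c * x i)) f = c ^ d * frag_eval (monomial_value x) f"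
        using homogeneous_in_scale by blast
      have "[frag_eval (monomial_value x) f = 0] (mod p)" using \<open>good x\<close> f by (simp add: good_def)
      then have "[c ^ d * frag_eval (monomial_value x) f = 0] (mod p)"
        by (metis cong_scalar_left mult_zero_right)
      then show ?thesis
        using value_restrict[OF f, of "\<lambda>i. c * x i"] d by (simp add: c(3) cong_iff_mod_eq)
    qed
    ultimately show ?thesis by (simp add: good_def)
  qed
  have aff: "x \<in> affine_points p U \<longleftrightarrow> x \<in> ?V \<and> x 0 = 1 \<and> good x" for x
    using p1 by (auto simp: affine_points_def good_def V_iff)
  have "bij_betw (\<lambda>x. rel `` {x}) (affine_points p U) (variety_points ?K U)"
  proof (rule bij_betw_imageI)
    show "inj_on (\<lambda>x. rel `` {x}) (affine_points p U)"
    proof (rule inj_onI)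
      fix x y assume x: "x \<in> affine_points p U" and y: "y \<in> affine_points p U"
        and eq: "rel `` {x} = rel `` {y}"
      have "(x, y) \<in> rel" using eq_equiv_class[OF eq equiv] y by (auto simp: aff)
      then obtain c where c: "0 < c" "c < p" "y = (\<lambda>i\<in>{..?N}. (c * x i) mod p)" using relD by blast
      \<comment> \<open>Compare coordinate 0, which is 1 on both sides.\<close>
      have "c = 1" using fun_cong[OF c(3), of 0] x y c by (simp add: aff)
      with c x show "x = y" using norm[of x] by (simp add: aff V_iff)
    qed
    show "(\<lambda>x. rel `` {x}) ` affine_points p U = variety_points ?K U"
    proof (intro equalityI subsetI)
      fix P assume "P \<in> (\<lambda>x. rel `` {x}) ` affine_points p U"
      then obtain x where x: "x \<in> ?V" "good x" "P = rel `` {x}" by (auto simp: aff)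
      then show "P \<in> variety_points ?K U"
        by (auto simp: pts quotientI good_rel)
    next
      fix P assume "P \<in> variety_points ?K U"
      then obtain y where y: "y \<in> ?V" "P = rel `` {y}" and P: "\<And>x. x \<in> P \<Longrightarrow> good x"
        by (auto simp: pts elim!: quotientE)
      have "y \<in> P" unfolding y(2) using equiv y(1) by (rule equiv_class_self)
      then have "\<not> p dvd y 0" using P[of y] by (simp add: good_def dvd_eq_mod_eq_0)
      \<comment> \<open>Scaling by the inverse of coordinate 0 gives the normalised
        representative.\<close>
      then obtain d where d: "[d * y 0 = 1] (mod p)" using inverse by blast
      let ?x = "\<lambda>i\<in>{..?N}. (d * y i) mod p"
      have "\<not> p dvd d" using d p1 by (auto simp: cong_iff_mod_eq dvd_def mult.assoc)
      then have yx: "(y, ?x) \<in> rel" using relI y by blast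
      then have "?x \<in> ?V" "good ?x" using P y by (auto simp: rel_def)
      moreover have "?x 0 = 1" using d p1 by (simp add: cong_iff_mod_eq)
      moreover have "P = rel `` {?x}" using equiv yx y by (simp add: equiv_class_eq)
      ultimately show "P \<in> (\<lambda>x. rel `` {x}) ` affine_points p U" using aff by blast
    qed
  qed
  then show ?thesis by (simp add: bij_betw_same_card)
qed


section \<open>Subspaces of coordinate space and reduced echelon matrices\<close>

locale coordinate_space =
  fixes n :: nat and p :: int
  assumes prime_p: "prime p"
begin

definition vectors :: "(nat \<Rightarrow> int) set"
  where "vectors = {..<n} \<rightarrow>\<^sub>E {0..<p}"

definition reduce :: "(nat \<Rightarrow> int) \<Rightarrow> nat \<Rightarrow> int"
  where "reduce f = (\<lambda>i\<in>{..<n}. f i mod p)"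

lemma p_gt_1: "p > 1"
  using prime_p by (simp add: prime_gt_1_int)

lemma reduce_in_vectors [simp]: "reduce f \<in> vectors"
  using p_gt_1 by (auto simp: reduce_def vectors_def)

lemma reduce_cong: "i < n \<Longrightarrow> [reduce f i = f i] (mod p)"
  by (simp add: reduce_def cong_iff_mod_eq)

lemma reduce_eq_0: "[reduce f i = 0] (mod p) \<Longrightarrow> i < n \<Longrightarrow> reduce f i = 0"
  by (simp add: reduce_def cong_iff_mod_eq)

lemma reduce_eq_iff: "reduce f = reduce g \<longleftrightarrow> (\<forall>i<n. [f i = g i] (mod p))"
  by (auto simp: reduce_def cong_iff_mod_eq fun_eq_iff)

lemma reduce_vector: "v \<in> vectors \<Longrightarrow> reduce v = v"
  by (fastforce simp: fun_eq_iff reduce_def vectors_def PiE_iff extensional_def)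

lemma vectors_eqI:
  assumes "u \<in> vectors" "v \<in> vectors" "\<And>i. i < n \<Longrightarrow> [u i = v i] (mod p)"
  shows "u = v"
  using assms reduce_eq_iff[of u v] by (simp add: reduce_vector)

lemma finite_vectors [simp]: "finite vectors"
  by (auto simp: vectors_def intro: finite_PiE)

lemma card_vectors: "card vectors = nat p ^ n"
  by (simp add: vectors_def card_PiE)

lemma inverse_mod_p:
  assumes "\<not> [c = 0] (mod p)"
  obtains d where "[d * c = 1] (mod p)"
  using assms prime_p cong_solve_coprime_int[of c p]
  by (metis cong_0_iff coprime_commute mult.commute prime_imp_coprime)

section \<open>Subspaces of coordinate space and closure under integer combinations\<close>

definition subspace :: "(nat \<Rightarrow> int) set \<Rightarrow> bool"
  where "subspace H \<longleftrightarrow> H \<subseteq> vectors \<and> reduce (\<lambda>_. 0) \<in> H \<and>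
    (\<forall>u\<in>H. \<forall>v\<in>H. reduce (\<lambda>i. u i + v i) \<in> H) \<and>
    (\<forall>c\<in>{0..<p}. \<forall>u\<in>H. reduce (\<lambda>i. c * u i) \<in> H)"

lemma subspace_scale:
  assumes "subspace H" "u \<in> H"
  shows "reduce (\<lambda>i. c * u i) \<in> H"
proof -
  have "reduce (\<lambda>i. c * u i) = reduce (\<lambda>i. (c mod p) * u i)"
    by (simp add: reduce_eq_iff cong_iff_mod_eq mod_simps)
  moreover have "c mod p \<in> {0..<p}" using p_gt_1 by simp
  ultimately show ?thesis using assms unfolding subspace_def by metis
qed

lemma subspace_sum:
  assumes H: "subspace H" and w: "\<And>s. s \<in> S \<Longrightarrow> w s \<in> H"
  shows "reduce (\<lambda>i. \<Sum>s\<in>S. c s * w s i) \<in> H"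
  using w
proof (induction S rule: infinite_finite_induct)
  case (insert s S)
  have "reduce (\<lambda>i. \<Sum>s\<in>insert s S. c s * w s i)
      = reduce (\<lambda>i. reduce (\<lambda>i. c s * w s i) i + reduce (\<lambda>i. \<Sum>s\<in>S. c s * w s i) i)"
    using insert.hyps by (simp add: reduce_eq_iff cong_iff_mod_eq) (simp add: reduce_def mod_simps)
  moreover have "reduce (\<lambda>i. c s * w s i) \<in> H" using H insert.prems by (simp add: subspace_scale)
  ultimately show ?case using insert H by (simp add: subspace_def)
\<comment> \<open>Left over are the empty and the infinite index set, where the sum is 0.\<close>
qed (use H in \<open>auto simp: subspace_def\<close>)

lemma subspace_lincomb2:
  assumes "subspace H" "u \<in> H" "v \<in> H"
  shows "reduce (\<lambda>i. a * u i + b * v i) \<in> H"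
  using subspace_sum[OF assms(1), of "UNIV :: bool set" "\<lambda>t. if t then u else v" "\<lambda>t. if t then a else b"] assms
  by (simp add: UNIV_bool add.commute)

text \<open>For arbitrary \<open>M\<close> this is the fixed space of right multiplication by
  \<open>M\<close>. A fixed vector is the combination of the rows with its own entries as
  coefficients, so this is the span of the rows as soon as the rows themselves are fixed.\<close>

definition row_space :: "(nat \<Rightarrow> nat \<Rightarrow> int) \<Rightarrow> (nat \<Rightarrow> int) set"
  where "row_space M = {v \<in> vectors. \<forall>j<n. [v j = (\<Sum>i<n. v i * M i j)] (mod p)}"

lemma reduce_in_row_space:
  "reduce f \<in> row_space M \<longleftrightarrow> (\<forall>j<n. [f j = (\<Sum>i<n. f i * M i j)] (mod p))"
proof -
  have "[(\<Sum>i<n. reduce f i * M i j) = (\<Sum>i<n. f i * M i j)] (mod p)" for j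
    by (intro cong_sum cong_mult reduce_cong) auto
  then show ?thesis
    unfolding row_space_def using reduce_cong[of _ f] by (simp add: cong_iff_mod_eq)
qed

lemma subspace_row_space: "subspace (row_space M)"
proof -
  have "reduce (\<lambda>i. u i + v i) \<in> row_space M" if "u \<in> row_space M" "v \<in> row_space M" for u v
    unfolding reduce_in_row_space using that
    by (auto simp: row_space_def distrib_right sum.distrib intro: cong_add)
  moreover have "reduce (\<lambda>i. c * u i) \<in> row_space M" if "u \<in> row_space M" for u c
    unfolding reduce_in_row_space using that
    by (auto simp: row_space_def mult.assoc simp flip: sum_distrib_left intro: cong_mult)
  moreover have "reduce (\<lambda>i. 0) \<in> row_space M" unfolding reduce_in_row_space by simp
  ultimately show ?thesis unfolding subspace_def by (auto simp: row_space_def)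
qed

text \<open>The row whose pivot is in column \<open>i\<close> is stored as row \<open>i\<close>:
  pivots sit on the diagonal and the matrix is upper triangular. Only entries with both indices
  below \<open>n\<close> are constrained, so uniqueness can be claimed only for those.\<close>

definition echelon :: "nat set \<Rightarrow> (nat \<Rightarrow> nat \<Rightarrow> int) \<Rightarrow> bool"
  where "echelon S M \<longleftrightarrow> S \<subseteq> {..<n} \<and> (\<forall>i<n. \<forall>j<n. M i j \<in> {0..<p}) \<and>
    (\<forall>i<n. \<forall>j<n. (i \<notin> S \<or> j < i \<or> (j \<in> S \<and> j \<noteq> i)) \<longrightarrow> M i j = 0) \<and> (\<forall>i\<in>S. M i i = 1)"

lemma echelonD:
  assumes "echelon S M"
  shows "i \<in> S \<Longrightarrow> i < n" "i < n \<Longrightarrow> j < n \<Longrightarrow> M i j \<in> {0..<p}"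
    "i < n \<Longrightarrow> j < n \<Longrightarrow> i \<notin> S \<Longrightarrow> M i j = 0" "i < n \<Longrightarrow> j < i \<Longrightarrow> M i j = 0"
    "i < n \<Longrightarrow> j \<in> S \<Longrightarrow> j \<noteq> i \<Longrightarrow> M i j = 0" "i \<in> S \<Longrightarrow> M i i = 1"
  using assms unfolding echelon_def by (auto simp: subset_iff)

lemma echelon_sum:
  assumes "echelon S M" "j < n"
  shows "(\<Sum>i<n. f i * M i j) = (\<Sum>i\<in>S. f i * M i j)"
  by (rule sum.mono_neutral_right) (use assms in \<open>auto simp: echelon_def\<close>)

text \<open>A pivot column is a unit vector, so a combination of rows shows its coefficients at the
  pivots.\<close>

lemma echelon_sum_pivot:
  assumes "echelon S M" "j \<in> S"
  shows "(\<Sum>i\<in>S. f i * M i j) = f j"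
proof -
  have "finite S" using assms by (auto simp: echelon_def intro: finite_subset)
  have "(\<Sum>i\<in>S. f i * M i j) = (\<Sum>i\<in>S. if i = j then f j else 0)"
    using echelonD[OF assms(1)] assms(2) by (intro sum.cong) auto
  then show ?thesis using \<open>finite S\<close> assms by simp
qed

text \<open>This is idempotence. A nonzero term \<open>M i k * M k j\<close> needs
  \<open>k \<in> S\<close>, and then row \<open>i\<close> vanishes in the pivot column
  \<open>k\<close> unless \<open>k = i\<close>.\<close>

lemma echelon_rows:
  assumes M: "echelon S M" and i: "i < n"
  shows "reduce (M i) \<in> row_space M"
proof -
  have "(\<Sum>k<n. M i k * M k j) = M i j" if j: "j < n" for j
  proof (cases "i \<in> S")
    case True
    have "M i k * M k j = 0" if "k < n" "k \<noteq> i" for k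
      using echelonD(3)[OF M that(1) j] echelonD(5)[OF M i _ that(2)] by (cases "k \<in> S") auto
    then have "(\<Sum>k<n. M i k * M k j) = (\<Sum>k<n. if k = i then M i j else 0)"
      using echelonD(6)[OF M True] by (intro sum.cong) auto
    then show ?thesis using i by simp
  next
    case False
    then show ?thesis using M i j by (auto simp: echelon_def)
  qed
  then show ?thesis by (simp add: reduce_in_row_space)
qed

text \<open>The entries at the pivots are free coordinates: they can be prescribed arbitrarily, and
  they are the coefficients that rebuild the vector from the rows.\<close>

lemma card_row_space:
  assumes M: "echelon S M"
  shows "card (row_space M) = nat p ^ card S"
proof -
  let ?f = "\<lambda>w. reduce (\<lambda>j. \<Sum>s\<in>S. w s * M s j)"
  have S: "S \<subseteq> {..<n}" using M by (simp add: echelon_def)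
  have fin: "finite S" using S finite_subset by blast
  have f: "?f v = v" if v: "v \<in> row_space M" for v
  proof (rule vectors_eqI)
    fix j assume j: "j < n"
    have "[v j = (\<Sum>s\<in>S. v s * M s j)] (mod p)"
      using v j echelon_sum[OF M j, of v] unfolding row_space_def by auto
    then show "[?f v j = v j] (mod p)"
      using reduce_cong[OF j] cong_sym cong_trans by meson
  qed (use v in \<open>auto simp: row_space_def\<close>)
  have "bij_betw (\<lambda>v. restrict v S) (row_space M) (S \<rightarrow>\<^sub>E {0..<p})"
  proof (rule bij_betw_byWitness[where f' = ?f])
    show "\<forall>v\<in>row_space M. ?f (restrict v S) = v"
      using f by simp
    show "\<forall>w\<in>S \<rightarrow>\<^sub>E {0..<p}. restrict (?f w) S = w"
    proof
      fix w assume w: "w \<in> S \<rightarrow>\<^sub>E {0..<p}"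
      have "?f w s = w s" if "s \<in> S" for s
        using PiE_mem[OF w that] echelonD(1)[OF M that] echelon_sum_pivot[OF M that, of w] by (simp add: reduce_def)
      then show "restrict (?f w) S = w" using w by (auto simp: fun_eq_iff PiE_iff extensional_def)
    qed
    show "(\<lambda>v. restrict v S) ` row_space M \<subseteq> S \<rightarrow>\<^sub>E {0..<p}"
      using S by (auto simp: row_space_def vectors_def PiE_iff)
    show "?f ` (S \<rightarrow>\<^sub>E {0..<p}) \<subseteq> row_space M"
    proof clarify
      fix w
      have "?f w = reduce (\<lambda>j. \<Sum>s\<in>S. w s * reduce (M s) j)"
        unfolding reduce_eq_iff
        by (intro allI impI cong_sum cong_mult cong_sym[OF reduce_cong]) auto
      then show "?f w \<in> row_space M"
        using subspace_sum[OF subspace_row_space, of S "\<lambda>s. reduce (M s)" M w] echelon_rows[OF M] S by auto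
    qed
  qed
  then show ?thesis using fin by (simp add: bij_betw_same_card card_PiE)
qed

text \<open>Recovers the pivots from the row space alone, as the positions where a vector of the
  space can have its leading 1.\<close>

lemma echelon_pivots:
  assumes M: "echelon S M"
  shows "S = {i. i < n \<and> (\<exists>v\<in>row_space M. v i = 1 \<and> (\<forall>j<i. v j = 0))}"
proof (intro equalityI subsetI CollectI conjI)
  fix i assume i: "i \<in> S"
  then show "i < n" using M by (auto simp: echelon_def)
  then have "reduce (M i) i = 1" "\<forall>j<i. reduce (M i) j = 0"
    using M i p_gt_1 by (auto simp: reduce_def echelon_def)
  then show "\<exists>v\<in>row_space M. v i = 1 \<and> (\<forall>j<i. v j = 0)"
    using echelon_rows[OF M \<open>i < n\<close>] by blast
next
  fix i assume "i \<in> {i. i < n \<and> (\<exists>v\<in>row_space M. v i = 1 \<and> (\<forall>j<i. v j = 0))}"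
  then obtain v where i: "i < n" and v: "v \<in> row_space M" "v i = 1" "\<And>j. j < i \<Longrightarrow> v j = 0" by auto
  show "i \<in> S"
  proof (rule ccontr)
    assume "i \<notin> S"
    \<comment> \<open>For \<open>s < i\<close> the entry \<open>v s\<close> is 0, and for
      \<open>i < s\<close> row \<open>s\<close> is still 0 in column \<open>i\<close>.\<close>
    then have "v s * M s i = 0" if "s \<in> S" for s
      using echelonD(4)[OF M echelonD(1)[OF M that], of i] \<open>i \<notin> S\<close> that v(3)[of s]
      by (cases i s rule: linorder_cases) auto
    then have "(\<Sum>s\<in>S. v s * M s i) = 0" by (intro sum.neutral) auto
    then have "[1 = 0] (mod p)"
      using v i echelon_sum[OF M i, of v] by (auto simp: row_space_def)
    then show False using p_gt_1 by (simp add: cong_iff_mod_eq)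
  qed
qed

text \<open>With the same pivots on both sides, row \<open>i\<close> of \<open>M'\<close> is a
  combination of rows of \<open>M\<close> whose coefficients are its own pivot entries, namely 1 at
  \<open>i\<close> and 0 elsewhere.\<close>

lemma echelon_unique:
  assumes M: "echelon S M" and M': "echelon S' M'" and eq: "row_space M = row_space M'"
  shows "S = S'" "\<And>i j. i < n \<Longrightarrow> j < n \<Longrightarrow> M i j = M' i j"
proof -
  show S: "S = S'" using echelon_pivots[OF M] echelon_pivots[OF M'] eq by simp
  fix i j assume i: "i < n" and j: "j < n"
  show "M i j = M' i j"
  proof (cases "i \<in> S")
    case True
    have "reduce (M' i) \<in> row_space M" using echelon_rows[OF M' i] eq by simp
    then have "[M' i j = (\<Sum>k\<in>S. M' i k * M k j)] (mod p)"
      using j echelon_sum[OF M j, of "M' i"] by (auto simp: reduce_in_row_space)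
    moreover have "(\<Sum>k\<in>S. M' i k * M k j) = (\<Sum>k\<in>S. if k = i then M i j else 0)"
      using echelonD[OF M'] S i True by (intro sum.cong) auto
    moreover have "finite S" using M by (auto simp: echelon_def intro: finite_subset)
    ultimately have "[M' i j = M i j] (mod p)" using True by simp
    then show ?thesis using echelonD(2)[OF M i j] echelonD(2)[OF M' i j] by (simp add: cong_iff_mod_eq)
  next
    case False
    then show ?thesis using M M' S i j by (simp add: echelon_def)
  qed
qed

text \<open>Gaussian elimination carried out inside \<open>H\<close>: \<open>S\<close> collects the
  leading positions of its vectors, and for each a vector with leading 1 is chosen and cleared at
  all later positions of \<open>S\<close>.\<close>

lemma exists_echelon:
  assumes H: "subspace H"
  obtains S M where "echelon S M" "row_space M = H"
proof -
  define S where "S = {i. i < n \<and> (\<exists>v\<in>H. v i = 1 \<and> (\<forall>j<i. v j = 0))}"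
  have HV: "H \<subseteq> vectors" using H by (simp add: subspace_def)
  \<comment> \<open>Clearing proceeds from left to right. A vector with leading position
    \<open>k\<close> vanishes before \<open>k\<close>, so subtracting a multiple of it leaves the
    columns already cleared untouched.\<close>
  have lead: "\<exists>v\<in>H. v i = 1 \<and> (\<forall>j<i. v j = 0) \<and> (\<forall>j\<in>S. i < j \<and> j < k \<longrightarrow> v j = 0)"
    if i: "i \<in> S" and "k \<le> n" for i k
    using \<open>k \<le> n\<close>
  proof (induction k)
    case 0
    then show ?case using i by (auto simp: S_def)
  next
    case (Suc k)
    then obtain v where v: "v \<in> H" "v i = 1" "\<And>j. j < i \<Longrightarrow> v j = 0"
      "\<And>j. j \<in> S \<Longrightarrow> i < j \<Longrightarrow> j < k \<Longrightarrow> v j = 0" by auto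
    show ?case
    proof (cases "k \<in> S \<and> i < k")
      case True
      then obtain w where w: "w \<in> H" "w k = 1" "\<And>j. j < k \<Longrightarrow> w j = 0" by (auto simp: S_def)
      let ?u = "reduce (\<lambda>j. 1 * v j + (- v k) * w j)"
      have "?u \<in> H" using H v(1) w(1) by (rule subspace_lincomb2)
      moreover have "?u j = v j mod p" if "j < k" for j
        using that w(3)[of j] Suc.prems by (simp add: reduce_def)
      moreover have "?u k = 0" using Suc.prems w(2) by (simp add: reduce_def)
      ultimately show ?thesis
        using True v p_gt_1 by (intro bexI[of _ ?u]) (auto simp: less_Suc_eq)
    next
      case False
      then show ?thesis using v by (intro bexI[of _ v]) (auto simp: less_Suc_eq)
    qed
  qed
  have "\<exists>v. v \<in> H \<and> v i = 1 \<and> (\<forall>j<i. v j = 0) \<and> (\<forall>j\<in>S. i < j \<longrightarrow> v j = 0)" if "i \<in> S" for i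
    using lead[OF that, of n] by (auto simp: S_def)
  then obtain B where B: "\<And>i. i \<in> S \<Longrightarrow> B i \<in> H" "\<And>i. i \<in> S \<Longrightarrow> B i i = 1"
    "\<And>i j. i \<in> S \<Longrightarrow> j < i \<Longrightarrow> B i j = 0" "\<And>i j. i \<in> S \<Longrightarrow> j \<in> S \<Longrightarrow> i < j \<Longrightarrow> B i j = 0"
    by metis
  define M where "M = (\<lambda>i. if i \<in> S then B i else reduce (\<lambda>_. 0))"
  have MH: "M i \<in> H" for i using B(1) H by (simp add: M_def subspace_def)
  then have MV: "M i \<in> vectors" for i using HV by auto
  have ech: "echelon S M"
    unfolding echelon_def
  proof (intro conjI allI impI ballI)
    show "S \<subseteq> {..<n}" by (auto simp: S_def)
    show "M i j \<in> {0..<p}" if "j < n" for i j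
      using MV[of i] that by (auto simp: vectors_def PiE_iff)
    show "M i j = 0" if "i < n" "j < n" "i \<notin> S \<or> j < i \<or> (j \<in> S \<and> j \<noteq> i)" for i j
      using that B(3)[of i j] B(4)[of i j] by (cases i j rule: linorder_cases) (auto simp: M_def reduce_def)
    show "M i i = 1" if "i \<in> S" for i using B(2) that by (simp add: M_def)
  qed
  have "row_space M = H"
  proof (intro equalityI subsetI)
    fix v assume v: "v \<in> row_space M"
    then have "v = reduce (\<lambda>j. \<Sum>i<n. v i * M i j)"
      by (intro vectors_eqI reduce_in_vectors) (auto simp: row_space_def reduce_def cong_iff_mod_eq)
    moreover have "reduce (\<lambda>j. \<Sum>i<n. v i * M i j) \<in> H" by (intro subspace_sum H MH)
    ultimately show "v \<in> H" by simp
  next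
    fix v assume v: "v \<in> H"
    let ?s = "reduce (\<lambda>j. \<Sum>i<n. v i * M i j)"
    \<comment> \<open>The remainder of \<open>v\<close> after subtracting the combination of rows
      with the same pivot entries; it vanishes at all pivots.\<close>
    let ?u = "reduce (\<lambda>j. 1 * v j + (- 1) * ?s j)"
    have "?s \<in> H" by (intro subspace_sum H MH)
    then have u: "?u \<in> H" using H v subspace_lincomb2 by blast
    have s_cong: "[?s j = (\<Sum>i\<in>S. v i * M i j)] (mod p)" if "j < n" for j
      using reduce_cong[OF that, of "\<lambda>j. \<Sum>i<n. v i * M i j"] echelon_sum[OF ech that, of v] by simp
    have u_cong: "[?u j = v j - ?s j] (mod p)" if "j < n" for j
      using reduce_cong[OF that, of "\<lambda>j. 1 * v j + (- 1) * ?s j"] by simp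
    have zero: "?u i = 0" if "i \<in> S" for i
    proof -
      have "i < n" using that by (simp add: S_def)
      then have "[?u i = 0] (mod p)"
        using cong_trans[OF u_cong cong_diff[OF cong_refl s_cong], of i] echelon_sum_pivot[OF ech that, of v]
        by simp
      then show ?thesis using \<open>i < n\<close> by (rule reduce_eq_0)
    qed
    \<comment> \<open>A nonzero remainder could be scaled to have a leading 1, at a position that
      would then belong to \<open>S\<close>; but at \<open>S\<close> the remainder is 0.\<close>
    have u0: "\<forall>j<n. ?u j = 0"
    proof (rule ccontr)
      assume "\<not> (\<forall>j<n. ?u j = 0)"
      then have ex: "\<exists>j. j < n \<and> ?u j \<noteq> 0" by blast
      define i where "i = (LEAST j. j < n \<and> ?u j \<noteq> 0)"
      have i: "i < n" "?u i \<noteq> 0" using LeastI_ex[OF ex] by (auto simp: i_def)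
      have less: "?u j = 0" if "j < i" for j
        using not_less_Least[of j "\<lambda>j. j < n \<and> ?u j \<noteq> 0"] that i(1) by (auto simp: i_def)
      have "?u i mod p = ?u i" using i(1) by (simp add: reduce_def)
      then have "\<not> [?u i = 0] (mod p)" using i(2) by (simp add: cong_iff_mod_eq)
      then obtain d where d: "[d * ?u i = 1] (mod p)" by (rule inverse_mod_p)
      let ?w = "reduce (\<lambda>j. d * ?u j)"
      have "?w \<in> H" using H u by (rule subspace_scale)
      moreover have "?w i = 1" using d i(1) p_gt_1 by (simp add: reduce_def[of "\<lambda>j. d * _ j"] cong_iff_mod_eq)
      moreover have "?w j = 0" if "j < i" for j
        using less[OF that] that i(1) by (simp add: reduce_def[of "\<lambda>j. d * _ j"])
      ultimately have "i \<in> S" using i(1) by (auto simp: S_def)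
      then show False using zero i by blast
    qed
    have "[v j = (\<Sum>i<n. v i * M i j)] (mod p)" if "j < n" for j
    proof -
      have "[v j - ?s j = 0] (mod p)" using u0 u_cong[OF that] that by (simp add: cong_sym_eq)
      then have "[v j = ?s j] (mod p)" by (simp add: cong_iff_dvd_diff cong_0_iff)
      then show ?thesis using reduce_cong[OF that] cong_trans by blast
    qed
    then show "v \<in> row_space M" using v HV by (auto simp: row_space_def)
  qed
  with ech that show thesis by blast
qed

section \<open>Subalgebras and ideals in coordinates\<close>

context
  fixes c :: "nat \<Rightarrow> nat \<Rightarrow> nat \<Rightarrow> int"
begin

definition coord_bracket :: "(nat \<Rightarrow> int) \<Rightarrow> (nat \<Rightarrow> int) \<Rightarrow> nat \<Rightarrow> int"
  where "coord_bracket u v = reduce (\<lambda>k. \<Sum>i<n. \<Sum>j<n. u i * v j * c i j k)"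

fun coord_counted :: "zeta_kind \<Rightarrow> (nat \<Rightarrow> int) set \<Rightarrow> bool"
  where
    "coord_counted Subalgebras H \<longleftrightarrow> subspace H \<and> (\<forall>u\<in>H. \<forall>v\<in>H. coord_bracket u v \<in> H)"
  | "coord_counted Ideals H \<longleftrightarrow> subspace H \<and> (\<forall>u\<in>vectors. \<forall>v\<in>H. coord_bracket u v \<in> H)"

text \<open>The row space of an idempotent matrix \<open>M\<close> is the kernel of \<open>M - 1\<close>; the expression
  below is entry \<open>l\<close> of \<open>[u, v] (M - 1)\<close>.\<close>

definition defect :: "(nat \<Rightarrow> nat \<Rightarrow> int) \<Rightarrow> (nat \<Rightarrow> int) \<Rightarrow> (nat \<Rightarrow> int) \<Rightarrow> nat \<Rightarrow> int"
  where "defect M u v l =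
    (\<Sum>i<n. \<Sum>j<n. \<Sum>k<n. c i j k * u i * v j * (M k l - of_bool (k = l)))"

lemma bracket_in_row_space:
  "coord_bracket u v \<in> row_space M \<longleftrightarrow> (\<forall>l<n. [defect M u v l = 0] (mod p))"
proof -
  define w where "w = (\<lambda>k. \<Sum>i<n. \<Sum>j<n. u i * v j * c i j k)"
  have "defect M u v l = (\<Sum>k<n. w k * M k l) - w l" if "l < n" for l
  proof -
    have "defect M u v l = (\<Sum>i<n. \<Sum>k<n. \<Sum>j<n. c i j k * u i * v j * (M k l - of_bool (k = l)))"
      unfolding defect_def by (subst sum.swap[of _ "{..<n}" "{..<n}"]) (rule refl)
    also have "\<dots> = (\<Sum>k<n. \<Sum>i<n. \<Sum>j<n. c i j k * u i * v j * (M k l - of_bool (k = l)))"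
      by (rule sum.swap)
    also have "\<dots> = (\<Sum>k<n. w k * (M k l - of_bool (k = l)))"
      unfolding w_def sum_distrib_right by (intro sum.cong refl) (simp add: mult_ac)
    also have "\<dots> = (\<Sum>k<n. w k * M k l) - (\<Sum>k<n. w k * of_bool (k = l))"
      by (simp add: right_diff_distrib sum_subtractf)
    also have "(\<Sum>k<n. w k * of_bool (k = l)) = w l"
      using that by (simp add: of_bool_def if_distrib[of "\<lambda>t. _ * t"] cong: if_cong)
    finally show ?thesis .
  qed
  then show ?thesis
    unfolding coord_bracket_def w_def[symmetric] reduce_in_row_space
    by (auto simp: cong_iff_dvd_diff dvd_diff_commute)
qed

lemma defect_cong:
  assumes "\<And>i. i < n \<Longrightarrow> [u i = u' i] (mod p)" "\<And>i. i < n \<Longrightarrow> [v i = v' i] (mod p)"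
  shows "[defect M u v l = defect M u' v' l] (mod p)"
  unfolding defect_def by (intro cong_sum cong_mult cong_refl assms) auto

lemma defect_linear:
  "defect M (\<lambda>i. r * f i + g i) v l = r * defect M f v l + defect M g v l"
  "defect M u (\<lambda>i. r * f i + g i) l = r * defect M u f l + defect M u g l"
  unfolding defect_def sum_distrib_left sum.distrib[symmetric]
  by (intro sum.cong refl, simp add: algebra_simps)+

lemma defect_sum:
  "defect M (\<lambda>i. \<Sum>a\<in>A. r a * f a i) v l = (\<Sum>a\<in>A. r a * defect M (f a) v l)"
  "defect M u (\<lambda>i. \<Sum>a\<in>A. r a * f a i) l = (\<Sum>a\<in>A. r a * defect M u (f a) l)"
  by (induction A rule: infinite_finite_induct)
    (simp_all add: defect_linear, simp_all add: defect_def)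

text \<open>By definition of \<open>row_space\<close>, its vectors are combinations of the rows, and
  \<open>defect\<close> is bilinear in its two vectors, so testing pairs of rows suffices. The
  separate matrix \<open>G\<close> for the left argument lets one statement cover subalgebras and
  ideals.\<close>

lemma row_space_bracket_closed:
  assumes G: "\<And>a. a < n \<Longrightarrow> reduce (G a) \<in> row_space G"
    and M: "\<And>b. b < n \<Longrightarrow> reduce (M b) \<in> row_space M"
  shows "(\<forall>u\<in>row_space G. \<forall>v\<in>row_space M. coord_bracket u v \<in> row_space M) \<longleftrightarrow>
    (\<forall>a<n. \<forall>b<n. \<forall>l<n. [defect M (G a) (M b) l = 0] (mod p))"
proof (intro iffI allI impI ballI)
  fix a b l assume closed: "\<forall>u\<in>row_space G. \<forall>v\<in>row_space M. coord_bracket u v \<in> row_space M"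
    and a: "a < n" and b: "b < n" and l: "l < n"
  have "[defect M (reduce (G a)) (reduce (M b)) l = 0] (mod p)"
    using closed G[OF a] M[OF b] l by (simp add: bracket_in_row_space)
  moreover have "[defect M (reduce (G a)) (reduce (M b)) l = defect M (G a) (M b) l] (mod p)"
    by (intro defect_cong reduce_cong)
  ultimately show "[defect M (G a) (M b) l = 0] (mod p)"
    by (metis cong_sym cong_trans)
next
  fix u v assume 0: "\<forall>a<n. \<forall>b<n. \<forall>l<n. [defect M (G a) (M b) l = 0] (mod p)"
    and u: "u \<in> row_space G" and v: "v \<in> row_space M"
  have "[defect M u v l = 0] (mod p)" if "l < n" for l
  proof -
    have "[defect M u v l = defect M (\<lambda>i. \<Sum>a<n. u a * G a i) (\<lambda>j. \<Sum>b<n. v b * M b j) l] (mod p)"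
      using u v by (intro defect_cong) (auto simp: row_space_def)
    also have "defect M (\<lambda>i. \<Sum>a<n. u a * G a i) (\<lambda>j. \<Sum>b<n. v b * M b j) l
        = (\<Sum>a<n. u a * (\<Sum>b<n. v b * defect M (G a) (M b) l))"
      by (simp add: defect_sum)
    also have "[\<dots> = (\<Sum>a<n. u a * (\<Sum>b<n. v b * 0))] (mod p)"
      by (intro cong_sum cong_mult cong_refl) (use 0 that in auto)
    finally show ?thesis by simp
  qed
  then show "coord_bracket u v \<in> row_space M" by (simp add: bracket_in_row_space)
qed

text \<open>An ideal absorbs brackets with the whole space, which is the row space of the identity
  matrix.\<close>

fun generator :: "zeta_kind \<Rightarrow> (nat \<Rightarrow> nat \<Rightarrow> int) \<Rightarrow> nat \<Rightarrow> nat \<Rightarrow> int"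
  where
    "generator Subalgebras M = M"
  | "generator Ideals M = (\<lambda>a i. of_bool (a = i))"

lemma row_space_identity: "row_space (\<lambda>a i. of_bool (a = i)) = vectors"
proof -
  have "(\<Sum>i<n. v i * of_bool (i = j)) = v j" if "j < n" for v :: "nat \<Rightarrow> int" and j
    using that by (simp add: of_bool_def if_distrib[of "\<lambda>t. _ * t"] cong: if_cong)
  then show ?thesis by (auto simp: row_space_def)
qed

lemma coord_counted_row_space:
  assumes M: "echelon S M"
  shows "coord_counted star (row_space M) \<longleftrightarrow>
    (\<forall>a<n. \<forall>b<n. \<forall>l<n. [defect M (generator star M a) (M b) l = 0] (mod p))"
proof (cases star)
  case Subalgebras
  then show ?thesis
    using row_space_bracket_closed[of M M] echelon_rows[OF M] by (simp add: subspace_row_space)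
next
  case Ideals
  then show ?thesis
    using row_space_bracket_closed[of "generator Ideals M" M] echelon_rows[OF M]
    by (simp add: subspace_row_space row_space_identity)
qed

end

end

section \<open>The echelon varieties\<close>

text \<open>Coordinate \<open>0\<close> of projective space is the homogenising variable, and the entry \<open>(i, j)\<close> of a
  matrix is the coordinate \<open>entry_index n i j\<close>.\<close>

definition entry_index :: "nat \<Rightarrow> nat \<Rightarrow> nat \<Rightarrow> nat"
  where "entry_index n i j = Suc (i * n + j)"

lemma entry_index_le:
  assumes "i < n" "j < n"
  shows "entry_index n i j \<le> n * n"
proof -
  have "i * n + j < Suc i * n" using assms by simp
  also have "\<dots> \<le> n * n" using assms by (intro mult_le_mono1) simp
  finally show ?thesis by (simp add: entry_index_def)
qed

text \<open>Subtracting 1 skips the homogenising coordinate; every other coordinate up to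
  \<open>n * n\<close> is a matrix entry.\<close>

lemma entry_index_div_mod:
  assumes "0 < k" "k \<le> n * n"
  shows "(k - 1) div n < n" "(k - 1) mod n < n" "entry_index n ((k - 1) div n) ((k - 1) mod n) = k"
proof -
  have "n > 0" using assms by (cases n) auto
  then show "(k - 1) mod n < n" by simp
  show "(k - 1) div n < n" using assms by (intro less_mult_imp_div_less) auto
  show "entry_index n ((k - 1) div n) ((k - 1) mod n) = k" using assms by (simp add: entry_index_def)
qed

text \<open>The condition that a pivot be 1 is homogenised to its difference with coordinate 0. The
  range condition of \<open>echelon\<close> has no polynomial here because coordinates of points are
  residues already.\<close>

definition echelon_polys :: "nat \<Rightarrow> nat set \<Rightarrow> int_mpoly set"
  where "echelon_polys n S =
    {term_poly 1 [entry_index n i j] | i j. i < n \<and> j < n \<and> (i \<notin> S \<or> j < i \<or> (j \<in> S \<and> j \<noteq> i))} \<union>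
    {term_poly 1 [entry_index n i i] + term_poly (- 1) [0] | i. i \<in> S}"

text \<open>Together with \<open>generator_coeff\<close> this writes an entry of
  \<open>generator\<close> as a coefficient times one variable. For ideals the entry is constant,
  and the variable is the homogenising one, which keeps the degree equal for both kinds.\<close>

fun generator_var :: "zeta_kind \<Rightarrow> nat \<Rightarrow> nat \<Rightarrow> nat \<Rightarrow> nat"
  where
    "generator_var Subalgebras n a i = entry_index n a i"
  | "generator_var Ideals n a i = 0"

fun generator_coeff :: "zeta_kind \<Rightarrow> nat \<Rightarrow> nat \<Rightarrow> int"
  where
    "generator_coeff Subalgebras a i = 1"
  | "generator_coeff Ideals a i = of_bool (a = i)"

text \<open>The \<open>defect\<close> at generator \<open>a\<close> and row \<open>b\<close>, as a
  form of degree 3. The contribution of the identity matrix has one variable fewer and is filled up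
  with coordinate 0.\<close>

definition closed_poly ::
  "zeta_kind \<Rightarrow> nat \<Rightarrow> (nat \<Rightarrow> nat \<Rightarrow> nat \<Rightarrow> int) \<Rightarrow> nat \<Rightarrow> nat \<Rightarrow> nat \<Rightarrow> int_mpoly"
  where "closed_poly star n c a b l = (\<Sum>i<n. \<Sum>j<n. \<Sum>k<n.
    term_poly (c i j k * generator_coeff star a i)
      [generator_var star n a i, entry_index n b j, entry_index n k l] +
    term_poly (- (c i j k * generator_coeff star a i * of_bool (k = l)))
      [generator_var star n a i, entry_index n b j, 0])"

definition echelon_variety ::
  "zeta_kind \<Rightarrow> nat \<Rightarrow> (nat \<Rightarrow> nat \<Rightarrow> nat \<Rightarrow> int) \<Rightarrow> nat set \<Rightarrow> variety"
  where "echelon_variety star n c S =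
    \<lparr>ambient_dim = n * n,
     vanishing = echelon_polys n S \<union> {closed_poly star n c a b l | a b l. a < n \<and> b < n \<and> l < n},
     nonvanishing = {term_poly 1 [0]}\<rparr>"

lemma is_variety_echelon_variety:
  assumes S: "S \<subseteq> {..<n}"
  shows "is_variety (echelon_variety star n c S)"
proof -
  have gen: "generator_var star n a i \<le> n * n" if "a < n" "i < n" for a i
    using that by (cases star) (simp_all add: entry_index_le)
  have linear: "homogeneous_degree (n * n) 1 (term_poly r [v])" if "v \<le> n * n" for r v
    using homogeneous_degree_term_poly[of "[v]"] that by simp
  have cubic: "homogeneous_degree (n * n) 3 (term_poly r [v, w, x])"
    if "v \<le> n * n" "w \<le> n * n" "x \<le> n * n" for r v w x
    using homogeneous_degree_term_poly[of "[v, w, x]"] that by (simp add: numeral_3_eq_3)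
  have closed: "homogeneous_in (n * n) (closed_poly star n c a b l)" if "a < n" "b < n" "l < n" for a b l
    unfolding closed_poly_def
    by (intro homogeneous_degree_imp[where d = 3] homogeneous_degree_sum homogeneous_degree_add cubic)
      (use that in \<open>simp_all add: gen entry_index_le\<close>)
  have ech: "homogeneous_in (n * n) f" if "f \<in> echelon_polys n S" for f
    using that S unfolding echelon_polys_def
    by (auto intro!: homogeneous_degree_imp homogeneous_degree_add linear entry_index_le)
  have "finite ((\<lambda>(i, j). term_poly 1 [entry_index n i j]) ` ({..<n} \<times> {..<n}) \<union>
      (\<lambda>i. term_poly 1 [entry_index n i i] + term_poly (- 1) [0]) ` {..<n})"
    by simp
  then have "finite (echelon_polys n S)"
    by (rule rev_finite_subset) (use S in \<open>auto simp: echelon_polys_def\<close>)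
  moreover have "{closed_poly star n c a b l | a b l. a < n \<and> b < n \<and> l < n}
      = (\<lambda>(a, b, l). closed_poly star n c a b l) ` ({..<n} \<times> {..<n} \<times> {..<n})"
    by (auto simp: image_iff) blast
  ultimately show ?thesis
    using closed ech homogeneous_degree_imp[OF linear[of 0 1]]
    by (auto simp: is_variety_def echelon_variety_def)
qed

section \<open>Points of the echelon varieties over the prime field\<close>

context coordinate_space
begin

abbreviation matrix_of :: "(nat \<Rightarrow> int) \<Rightarrow> nat \<Rightarrow> nat \<Rightarrow> int"
  where "matrix_of x i j \<equiv> x (entry_index n i j)"

lemma echelon_polys_vanish:
  assumes x: "x \<in> {..n * n} \<rightarrow>\<^sub>E {0..<p}" "x 0 = 1" and S: "S \<subseteq> {..<n}"
  shows "(\<forall>f\<in>echelon_polys n S. [frag_eval (monomial_value x) f = 0] (mod p)) \<longleftrightarrow> echelon S (matrix_of x)"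
proof -
  have range: "matrix_of x i j \<in> {0..<p}" if "i < n" "j < n" for i j
    using x entry_index_le[OF that] by (auto simp: PiE_iff)
  have 0: "[frag_eval (monomial_value x) (term_poly 1 [entry_index n i j]) = 0] (mod p) \<longleftrightarrow> matrix_of x i j = 0"
    if "i < n" "j < n" for i j
    using range[OF that] by (simp add: eval_term_poly cong_iff_mod_eq)
  have 1: "[frag_eval (monomial_value x) (term_poly 1 [entry_index n i i] + term_poly (- 1) [0]) = 0] (mod p)
      \<longleftrightarrow> matrix_of x i i = 1" if "i < n" for i
  proof -
    have "[matrix_of x i i - 1 = 0] (mod p) \<longleftrightarrow> [matrix_of x i i = 1] (mod p)"
      by (simp add: cong_iff_dvd_diff)
    also have "\<dots> \<longleftrightarrow> matrix_of x i i = 1"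
      using range[OF that that] p_gt_1 by (simp add: cong_iff_mod_eq)
    finally show ?thesis using x by (simp add: eval_term_poly frag_eval_add)
  qed
  have "(\<forall>f\<in>echelon_polys n S. [frag_eval (monomial_value x) f = 0] (mod p)) \<longleftrightarrow>
    (\<forall>i j. i < n \<and> j < n \<and> (i \<notin> S \<or> j < i \<or> (j \<in> S \<and> j \<noteq> i)) \<longrightarrow>
      [frag_eval (monomial_value x) (term_poly 1 [entry_index n i j]) = 0] (mod p)) \<and>
    (\<forall>i\<in>S. [frag_eval (monomial_value x) (term_poly 1 [entry_index n i i] + term_poly (- 1) [0]) = 0] (mod p))"
    unfolding echelon_polys_def by blast
  also have "\<dots> \<longleftrightarrow> echelon S (matrix_of x)"
    using 0 1 range S by (auto simp: echelon_def subset_iff)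
  finally show ?thesis .
qed

lemma closed_poly_value:
  assumes "x 0 = 1"
  shows "frag_eval (monomial_value x) (closed_poly star n c a b l)
    = defect c (matrix_of x) (generator star (matrix_of x) a) (matrix_of x b) l"
proof -
  have "generator star (matrix_of x) a i = generator_coeff star a i * x (generator_var star n a i)" for i
    using assms by (cases star) auto
  then show ?thesis
    unfolding closed_poly_def defect_def frag_eval_sum frag_eval_add eval_term_poly
    by (intro sum.cong refl) (simp add: assms algebra_simps)
qed

lemma affine_points_echelon_variety:
  assumes S: "S \<subseteq> {..<n}"
  shows "affine_points p (echelon_variety star n c S) = {x \<in> {..n * n} \<rightarrow>\<^sub>E {0..<p}. x 0 = 1 \<and>
    echelon S (matrix_of x) \<and> coord_counted c star (row_space (matrix_of x))}"
proof -
  have "(\<forall>f\<in>vanishing (echelon_variety star n c S). [frag_eval (monomial_value x) f = 0] (mod p)) \<longleftrightarrow>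
      echelon S (matrix_of x) \<and> coord_counted c star (row_space (matrix_of x))"
    if x: "x \<in> {..n * n} \<rightarrow>\<^sub>E {0..<p}" "x 0 = 1" for x
  proof -
    have "(\<forall>f\<in>vanishing (echelon_variety star n c S). [frag_eval (monomial_value x) f = 0] (mod p)) \<longleftrightarrow>
      (\<forall>f\<in>echelon_polys n S. [frag_eval (monomial_value x) f = 0] (mod p)) \<and>
      (\<forall>a<n. \<forall>b<n. \<forall>l<n. [frag_eval (monomial_value x) (closed_poly star n c a b l) = 0] (mod p))"
      unfolding echelon_variety_def by auto
    then show ?thesis
      unfolding echelon_polys_vanish[OF x S] closed_poly_value[of x, OF x(2)]
      using coord_counted_row_space[of S "matrix_of x" c star] by blast
  qed
  moreover have "ambient_dim (echelon_variety star n c S) = n * n" by (simp add: echelon_variety_def)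
  ultimately show ?thesis by (auto simp: affine_points_def)
qed

lemma row_space_cong:
  assumes "\<And>i j. i < n \<Longrightarrow> j < n \<Longrightarrow> M i j = M' i j"
  shows "row_space M = row_space M'"
  using assms by (simp add: row_space_def)

text \<open>Injectivity is uniqueness of the reduced echelon form: coordinate 0 is fixed to be 1,
  and all other coordinates are matrix entries. Surjectivity packs an echelon matrix into
  coordinates.\<close>

lemma bij_betw_echelon_points:
  assumes S: "S \<subseteq> {..<n}"
  shows "bij_betw (\<lambda>x. row_space (matrix_of x)) (affine_points p (echelon_variety star n c S))
    {H. coord_counted c star H \<and> (\<exists>M. echelon S M \<and> row_space M = H)}"
proof (rule bij_betw_imageI)
  show "inj_on (\<lambda>x. row_space (matrix_of x)) (affine_points p (echelon_variety star n c S))"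
  proof (rule inj_onI)
    fix x y assume "x \<in> affine_points p (echelon_variety star n c S)"
      and "y \<in> affine_points p (echelon_variety star n c S)"
      and eq: "row_space (matrix_of x) = row_space (matrix_of y)"
    then have x: "x \<in> {..n * n} \<rightarrow>\<^sub>E {0..<p}" "x 0 = 1" "echelon S (matrix_of x)"
      and y: "y \<in> {..n * n} \<rightarrow>\<^sub>E {0..<p}" "y 0 = 1" "echelon S (matrix_of y)"
      unfolding affine_points_echelon_variety[OF S] by auto
    show "x = y"
    proof (rule PiE_ext[OF x(1) y(1)])
      fix k assume k: "k \<in> {..n * n}"
      show "x k = y k"
      proof (cases "k = 0")
        case True
        then show ?thesis using x y by simp
      next
        case False
        with k have "0 < k" "k \<le> n * n" by auto
        from echelon_unique(2)[OF x(3) y(3) eq entry_index_div_mod(1,2)[OF this]]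
        show ?thesis unfolding entry_index_div_mod(3)[OF \<open>0 < k\<close> \<open>k \<le> n * n\<close>] .
      qed
    qed
  qed
  show "(\<lambda>x. row_space (matrix_of x)) ` affine_points p (echelon_variety star n c S)
      = {H. coord_counted c star H \<and> (\<exists>M. echelon S M \<and> row_space M = H)}"
  proof (intro equalityI subsetI)
    fix H assume "H \<in> {H. coord_counted c star H \<and> (\<exists>M. echelon S M \<and> row_space M = H)}"
    then obtain M where H: "coord_counted c star (row_space M)" "H = row_space M" and M: "echelon S M" by auto
    define x where "x = (\<lambda>k\<in>{..n * n}. if k = 0 then 1 else M ((k - 1) div n) ((k - 1) mod n))"
    have entry: "matrix_of x i j = M i j" if "i < n" "j < n" for i j
      using entry_index_le[OF that] that by (simp add: x_def entry_index_def)
    have "x \<in> {..n * n} \<rightarrow>\<^sub>E {0..<p}"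
      using p_gt_1 echelonD(2)[OF M] entry_index_div_mod(1,2)[of _ n] by (auto simp: x_def)
    moreover have "echelon S (matrix_of x)"
      using M unfolding echelon_def by (auto simp: entry subset_iff)
    moreover have "row_space (matrix_of x) = row_space M" by (intro row_space_cong entry)
    moreover have "x 0 = 1" by (simp add: x_def)
    ultimately have "x \<in> affine_points p (echelon_variety star n c S)"
      using H by (simp add: affine_points_echelon_variety[OF S])
    then show "H \<in> (\<lambda>x. row_space (matrix_of x)) ` affine_points p (echelon_variety star n c S)"
      using H \<open>row_space (matrix_of x) = row_space M\<close> by blast
  qed (auto simp: affine_points_echelon_variety[OF S])
qed

lemma coord_counted_subspace: "coord_counted c star H \<Longrightarrow> subspace H"
  by (cases star) auto

text \<open>The cells are the parts of the Schubert cells of a Grassmannian that consist of counted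
  subspaces. The pivot set is determined by the subspace, so cells are disjoint, and its size
  determines the cardinality.\<close>

lemma card_coord_counted:
  "card {H. coord_counted c star H \<and> card H = nat p ^ d} =
    (\<Sum>S | S \<subseteq> {..<n} \<and> card S = d. card (variety_points (residue_ring p) (echelon_variety star n c S)))"
proof -
  define cell where "cell S = {H. coord_counted c star H \<and> (\<exists>M. echelon S M \<and> row_space M = H)}" for S
  have card_cell: "card (cell S) = card (variety_points (residue_ring p) (echelon_variety star n c S))"
    if "S \<subseteq> {..<n}" for S
    using bij_betw_same_card[OF bij_betw_echelon_points[OF that]] is_variety_echelon_variety[OF that]
      card_variety_points_affine[OF prime_p, of "echelon_variety star n c S"]
    by (simp add: cell_def echelon_variety_def)
  have fin: "finite (cell S)" for S
    by (rule finite_subset[of _ "Pow vectors"]) (auto simp: cell_def row_space_def)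
  have "{H. coord_counted c star H \<and> card H = nat p ^ d} = (\<Union>S\<in>{S. S \<subseteq> {..<n} \<and> card S = d}. cell S)"
  proof (intro equalityI subsetI)
    fix H assume H: "H \<in> {H. coord_counted c star H \<and> card H = nat p ^ d}"
    then obtain S M where SM: "echelon S M" "row_space M = H"
      using exists_echelon coord_counted_subspace by blast
    then have "nat p ^ card S = nat p ^ d" using card_row_space[OF SM(1)] H by simp
    then have "card S = d" using p_gt_1 by (simp add: power_inject_exp)
    then show "H \<in> (\<Union>S\<in>{S. S \<subseteq> {..<n} \<and> card S = d}. cell S)"
      using SM H by (auto simp: cell_def echelon_def)
  next
    fix H assume "H \<in> (\<Union>S\<in>{S. S \<subseteq> {..<n} \<and> card S = d}. cell S)"
    then show "H \<in> {H. coord_counted c star H \<and> card H = nat p ^ d}"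
      by (auto simp: cell_def card_row_space)
  qed
  moreover have "cell S \<inter> cell T = {}" if "S \<noteq> T" for S T
    using that echelon_unique(1) by (force simp: cell_def)
  ultimately have "card {H. coord_counted c star H \<and> card H = nat p ^ d}
      = (\<Sum>S | S \<subseteq> {..<n} \<and> card S = d. card (cell S))"
    using fin by (simp add: card_UN_disjoint)
  then show ?thesis by (simp add: card_cell)
qed

end


section \<open>Coordinates on the base change\<close>

text \<open>A basis, encoded by generation together with dual coordinates: the additive functionals
  \<open>\<xi>\<close> take the place of linear independence.\<close>

locale based_lie_ring = lie_ring L for L (structure) +
  fixes n :: nat and e :: "nat \<Rightarrow> 'a" and \<xi> :: "'a \<Rightarrow> nat \<Rightarrow> int"
  assumes basis_closed: "i < n \<Longrightarrow> e i \<in> carrier L"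
    and coord_add: "\<lbrakk>x \<in> carrier L; y \<in> carrier L; i < n\<rbrakk> \<Longrightarrow> \<xi> (x \<oplus> y) i = \<xi> x i + \<xi> y i"
    and coord_basis: "\<lbrakk>i < n; j < n\<rbrakk> \<Longrightarrow> \<xi> (e i) j = of_bool (i = j)"
    and generated: "generate (add_monoid L) (e ` {..<n}) = carrier L"
begin

lemma basis_induct [consumes 1, case_names zero basis neg add]:
  assumes x: "x \<in> carrier L" and zero: "Q \<zero>" and basis: "\<And>i. i < n \<Longrightarrow> Q (e i)"
    and neg: "\<And>x. \<lbrakk>x \<in> carrier L; Q x\<rbrakk> \<Longrightarrow> Q (\<ominus> x)"
    and add: "\<And>x y. \<lbrakk>x \<in> carrier L; y \<in> carrier L; Q x; Q y\<rbrakk> \<Longrightarrow> Q (x \<oplus> y)"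
  shows "Q x"
proof -
  have "x \<in> generate (add_monoid L) (e ` {..<n})" using x generated by simp
  then show ?thesis
  proof (induction rule: generate.induct)
    case one
    then show ?case using zero by simp
  next
    case (incl h)
    then show ?case using basis by auto
  next
    case (inv h)
    then have "h \<in> carrier L" "Q h" using basis basis_closed by auto
    then show ?case using neg by (simp add: a_inv_def)
  next
    case (eng h1 h2)
    then show ?case using add by (simp add: generated)
  qed
qed

text \<open>Both sides are additive in \<open>x\<close> and agree on the basis. Stating this for
  integer functionals avoids forming linear combinations in \<open>L\<close>; applied in each
  argument of the bracket, it yields the structure constants.\<close>

lemma additive_expand:
  fixes \<phi> :: "'a \<Rightarrow> int"
  assumes add: "\<And>x y. \<lbrakk>x \<in> carrier L; y \<in> carrier L\<rbrakk> \<Longrightarrow> \<phi> (x \<oplus> y) = \<phi> x + \<phi> y"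
    and x: "x \<in> carrier L"
  shows "\<phi> x = (\<Sum>i<n. \<xi> x i * \<phi> (e i))"
proof -
  have additive_zero: "\<psi> \<zero> = 0" if "\<And>x y. \<lbrakk>x \<in> carrier L; y \<in> carrier L\<rbrakk> \<Longrightarrow> \<psi> (x \<oplus> y) = \<psi> x + \<psi> y"
    for \<psi> :: "'a \<Rightarrow> int"
    using that[of \<zero> \<zero>] by simp
  have additive_neg: "\<psi> (\<ominus> x) = - \<psi> x" if "\<And>x y. \<lbrakk>x \<in> carrier L; y \<in> carrier L\<rbrakk> \<Longrightarrow> \<psi> (x \<oplus> y) = \<psi> x + \<psi> y"
    and "x \<in> carrier L" for \<psi> :: "'a \<Rightarrow> int" and x
    using that(1)[of x "\<ominus> x"] that(2) additive_zero[OF that(1)] by (simp add: r_neg)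
  let ?s = "\<lambda>x. \<Sum>i<n. \<xi> x i * \<phi> (e i)"
  have s_add: "?s (x \<oplus> y) = ?s x + ?s y" if "x \<in> carrier L" "y \<in> carrier L" for x y
    using that by (simp add: coord_add distrib_right sum.distrib)
  show ?thesis
    using x
  proof (induction rule: basis_induct)
    case zero
    then show ?case using additive_zero[of \<phi>, OF add] additive_zero[of ?s, OF s_add] by simp
  next
    case (basis i)
    have "?s (e i) = (\<Sum>j<n. if j = i then \<phi> (e j) else 0)"
      by (intro sum.cong) (auto simp: coord_basis basis)
    with basis show ?case by simp
  next
    case (neg x)
    then show ?case using additive_neg[of \<phi> x, OF add] additive_neg[of ?s x, OF s_add] by simp
  next
    case (add x y)
    then show ?case using assms(1)[of x y] s_add[of x y] by simp
  qed
qed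

definition structure_const :: "nat \<Rightarrow> nat \<Rightarrow> nat \<Rightarrow> int"
  where "structure_const i j k = \<xi> (e i \<otimes> e j) k"

lemma coord_bracket_expand:
  assumes x: "x \<in> carrier L" and y: "y \<in> carrier L" and k: "k < n"
  shows "\<xi> (x \<otimes> y) k = (\<Sum>i<n. \<Sum>j<n. \<xi> x i * \<xi> y j * structure_const i j k)"
proof -
  have "\<xi> (x \<otimes> y) k = (\<Sum>i<n. \<xi> x i * \<xi> (e i \<otimes> y) k)"
    using additive_expand[of "\<lambda>x. \<xi> (x \<otimes> y) k", OF _ x] y k
    by (simp add: bracket_add_left bracket_closed coord_add)
  moreover have "\<xi> (e i \<otimes> y) k = (\<Sum>j<n. \<xi> y j * structure_const i j k)" if "i < n" for i
    using additive_expand[of "\<lambda>y. \<xi> (e i \<otimes> y) k", OF _ y] basis_closed[OF that] k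
    by (simp add: bracket_add_right bracket_closed coord_add structure_const_def)
  ultimately show ?thesis by (simp add: sum_distrib_left mult.assoc)
qed

lemma coord_zero: "i < n \<Longrightarrow> \<xi> \<zero> i = 0"
  using coord_add[of \<zero> \<zero> i] by simp

lemma coord_neg: "x \<in> carrier L \<Longrightarrow> i < n \<Longrightarrow> \<xi> (\<ominus> x) i = - \<xi> x i"
  using coord_add[of x "\<ominus> x" i] by (simp add: r_neg coord_zero)

end

section \<open>The relations of the tensor product as the kernel of the coordinates modulo
  \<open>p\<close>\<close>

locale tensor_coordinates = based_lie_ring L n e \<xi> + coordinate_space n p
  for L (structure) and n e \<xi> p
begin

abbreviation "K \<equiv> residue_ring p"
abbreviation "F \<equiv> tensor_free L K"
abbreviation "T \<equiv> tensor_rel L K"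
abbreviation "tensor_support \<equiv> carrier L \<times> {0..<p}"

lemma K_simps: "carrier K = {0..<p}" "a \<oplus>\<^bsub>K\<^esub> b = (a + b) mod p" "a \<otimes>\<^bsub>K\<^esub> b = (a * b) mod p"
  "\<zero>\<^bsub>K\<^esub> = 0" "\<one>\<^bsub>K\<^esub> = 1"
  by (auto simp: residue_ring_def)

lemma F_eq: "F = free_Abelian_group tensor_support"
  by (simp add: tensor_free_def K_simps)

lemma carrier_F: "f \<in> carrier F \<longleftrightarrow> Poly_Mapping.keys f \<subseteq> tensor_support"
  by (simp add: F_eq)

text \<open>An integer lift of the coordinate on the tensor product. It respects additivity in
  \<open>L\<close> exactly, but additivity in the field only modulo \<open>p\<close>.\<close>

definition tensor_coord :: "nat \<Rightarrow> ('a \<times> int \<Rightarrow>\<^sub>0 int) \<Rightarrow> int"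
  where "tensor_coord k f = frag_eval (\<lambda>(x, a). \<xi> x k * a) f"

definition tensor_coords :: "('a \<times> int \<Rightarrow>\<^sub>0 int) \<Rightarrow> nat \<Rightarrow> int"
  where "tensor_coords f = reduce (\<lambda>k. tensor_coord k f)"

abbreviation relators :: "('a \<times> int \<Rightarrow>\<^sub>0 int) set"
  where "relators \<equiv>
     {frag_of (x \<oplus> y, a) - frag_of (x, a) - frag_of (y, a) | x y a.
         x \<in> carrier L \<and> y \<in> carrier L \<and> a \<in> carrier K} \<union>
      {frag_of (x, a \<oplus>\<^bsub>K\<^esub> b) - frag_of (x, a) - frag_of (x, b) | x a b.
         x \<in> carrier L \<and> a \<in> carrier K \<and> b \<in> carrier K}"

lemma relators_subset: "relators \<subseteq> carrier F"
proof -
  have diff: "f - g \<in> carrier F" if "f \<in> carrier F" "g \<in> carrier F" for f g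
    using that keys_diff[of f g] by (auto simp: carrier_F)
  have gen: "frag_of (x, a) \<in> carrier F" if "x \<in> carrier L" "a \<in> carrier K" for x a
    using that by (simp add: carrier_F K_simps)
  have "(a + b) mod p \<in> carrier K" for a b using p_gt_1 by (simp add: K_simps)
  note mod_closed = this
  show ?thesis
  proof
    fix f assume "f \<in> relators"
    then show "f \<in> carrier F"
    proof (elim UnE CollectE exE conjE)
      fix x y a assume f: "f = frag_of (x \<oplus> y, a) - frag_of (x, a) - frag_of (y, a)"
        and x: "x \<in> carrier L" and y: "y \<in> carrier L" and a: "a \<in> carrier K"
      show ?thesis
        unfolding f by (intro diff gen a_closed x y a)
    next
      fix x a b assume f: "f = frag_of (x, a \<oplus>\<^bsub>K\<^esub> b) - frag_of (x, a) - frag_of (x, b)"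
        and x: "x \<in> carrier L" and a: "a \<in> carrier K" and b: "b \<in> carrier K"
      show ?thesis
        unfolding f K_simps(2) by (intro diff gen mod_closed x a b)
    qed
  qed
qed

lemma T_subgroup: "subgroup T F"
  unfolding tensor_rel_def
  by (rule group.generate_is_subgroup[OF _ relators_subset]) (simp add: F_eq)

lemma T_closed: "f \<in> T \<Longrightarrow> g \<in> T \<Longrightarrow> f + g \<in> T" "f \<in> T \<Longrightarrow> - f \<in> T" "0 \<in> T"
  "f \<in> T \<Longrightarrow> g \<in> T \<Longrightarrow> f - g \<in> T" "f \<in> T \<Longrightarrow> f \<in> carrier F"
proof -
  show add: "f \<in> T \<Longrightarrow> g \<in> T \<Longrightarrow> f + g \<in> T" for f g
    using subgroup.m_closed[OF T_subgroup, of f g] by (simp add: F_eq)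
  show sub: "f \<in> T \<Longrightarrow> f \<in> carrier F" for f
    using subgroup.mem_carrier[OF T_subgroup] .
  show neg: "f \<in> T \<Longrightarrow> - f \<in> T" for f
    using subgroup.m_inv_closed[OF T_subgroup, of f] sub[of f] by (simp add: F_eq carrier_F)
  show "0 \<in> T" using subgroup.one_closed[OF T_subgroup] by (simp add: F_eq)
  show "f \<in> T \<Longrightarrow> g \<in> T \<Longrightarrow> f - g \<in> T" using add[of f "- g"] neg[of g] by simp
qed

lemma relators_in_T: "f \<in> relators \<Longrightarrow> f \<in> T"
  unfolding tensor_rel_def by (rule generate.incl)

lemma relator_add_left:
  "\<lbrakk>x \<in> carrier L; y \<in> carrier L; a \<in> {0..<p}\<rbrakk> \<Longrightarrow> frag_of (x \<oplus> y, a) - frag_of (x, a) - frag_of (y, a) \<in> T"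
  by (rule relators_in_T, rule UnI1, rule CollectI, intro exI[of _ x] exI[of _ y] exI[of _ a])
    (simp add: K_simps)

lemma relator_add_right:
  "\<lbrakk>x \<in> carrier L; a \<in> {0..<p}; b \<in> {0..<p}\<rbrakk> \<Longrightarrow> frag_of (x, (a + b) mod p) - frag_of (x, a) - frag_of (x, b) \<in> T"
  by (rule relators_in_T, rule UnI2, rule CollectI, intro exI[of _ x] exI[of _ a] exI[of _ b])
    (simp add: K_simps)

lemma tensor_coord_simps:
  "tensor_coord k 0 = 0" "tensor_coord k (frag_of (x, a)) = \<xi> x k * a"
  "tensor_coord k (f + g) = tensor_coord k f + tensor_coord k g"
  "tensor_coord k (f - g) = tensor_coord k f - tensor_coord k g"
  "tensor_coord k (- f) = - tensor_coord k f"
  by (simp_all add: tensor_coord_def frag_eval_add frag_eval_diff frag_eval_minus)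

lemma relators_coord_zero:
  assumes "f \<in> relators" and k: "k < n"
  shows "[tensor_coord k f = 0] (mod p)"
  using assms(1)
proof (elim UnE CollectE exE conjE)
  fix x y a assume "x \<in> carrier L" "y \<in> carrier L"
    and f: "f = frag_of (x \<oplus> y, a) - frag_of (x, a) - frag_of (y, a)"
  then show ?thesis using k unfolding f by (simp add: tensor_coord_simps coord_add distrib_right)
next
  fix x a b assume f: "f = frag_of (x, a \<oplus>\<^bsub>K\<^esub> b) - frag_of (x, a) - frag_of (x, b)"
  have "[\<xi> x k * ((a + b) mod p) = \<xi> x k * (a + b)] (mod p)" by (simp add: cong_iff_mod_eq mod_simps)
  then show ?thesis
    unfolding f by (simp add: tensor_coord_simps K_simps cong_iff_dvd_diff distrib_left diff_diff_add)
qed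

lemma T_coord_zero:
  assumes "f \<in> T" and k: "k < n"
  shows "[tensor_coord k f = 0] (mod p)"
  using assms(1) unfolding tensor_rel_def
proof (induction rule: generate.induct)
  case one
  then show ?case by (simp add: F_eq tensor_coord_simps)
next
  case (incl f)
  then show ?case using k by (rule relators_coord_zero)
next
  case (inv f)
  then have "[tensor_coord k f = 0] (mod p)" using k by (rule relators_coord_zero)
  \<comment> \<open>The group inverse is identified with negation on the carrier, so the support has
    to be checked.\<close>
  moreover have "Poly_Mapping.keys f \<subseteq> tensor_support"
    using subsetD[OF relators_subset inv] by (simp only: carrier_F)
  then have "inv\<^bsub>F\<^esub> f = - f" by (simp only: F_eq inv_free_Abelian_group)
  ultimately show ?case using cong_minus_minus_iff[of "tensor_coord k f" 0 p] by (simp add: tensor_coord_simps)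
next
  case (eng f g)
  then show ?case using cong_add[of "tensor_coord k f" 0 p "tensor_coord k g" 0]
    by (simp add: F_eq tensor_coord_simps)
qed

text \<open>One pure tensor for each basis element. Reducing the entries makes the element depend
  only on residues, so congruent vectors give equal elements and not merely equivalent ones.\<close>

definition normal_form :: "(nat \<Rightarrow> int) \<Rightarrow> 'a \<times> int \<Rightarrow>\<^sub>0 int"
  where "normal_form w = (\<Sum>i<n. frag_of (e i, w i mod p))"

lemma T_sum: "(\<And>i. i \<in> I \<Longrightarrow> f i \<in> T) \<Longrightarrow> (\<Sum>i\<in>I. f i) \<in> T"
  by (induction I rule: infinite_finite_induct) (auto simp: T_closed)

lemma normal_form_cong: "(\<And>i. i < n \<Longrightarrow> [w i = w' i] (mod p)) \<Longrightarrow> normal_form w = normal_form w'"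
  unfolding normal_form_def by (intro sum.cong) (auto simp: cong_iff_mod_eq)

lemma normal_form_add: "normal_form (\<lambda>i. u i + v i) - normal_form u - normal_form v \<in> T"
proof -
  have "frag_of (e i, (u i + v i) mod p) - frag_of (e i, u i mod p) - frag_of (e i, v i mod p) \<in> T" if "i < n" for i
    using relator_add_right[of "e i" "u i mod p" "v i mod p"] basis_closed[OF that] p_gt_1 by (simp add: mod_simps)
  then show ?thesis
    unfolding normal_form_def sum_subtractf[symmetric] by (intro T_sum) simp
qed

text \<open>The relation for \<open>0 + 0\<close> is minus this generator.\<close>

lemma frag_zero_right: "x \<in> carrier L \<Longrightarrow> frag_of (x, 0) \<in> T"
  using T_closed(2)[OF relator_add_right[of x 0 0]] p_gt_1 by simp

lemma normal_form_zero: "normal_form (\<lambda>_. 0) \<in> T"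
  unfolding normal_form_def by (intro T_sum) (simp add: frag_zero_right basis_closed)

lemma normal_form_diff: "normal_form (\<lambda>i. u i - v i) - (normal_form u - normal_form v) \<in> T"
  using T_closed(2)[OF normal_form_add[of "\<lambda>i. u i - v i" v]] by (simp add: algebra_simps)

text \<open>Induction over \<open>x\<close> with \<open>a\<close> fixed: additivity in
  \<open>L\<close> splits the pure tensor, and additivity of the normal form modulo \<open>T\<close>
  follows it.\<close>

lemma frag_of_normal_form:
  assumes "x \<in> carrier L" and a: "a \<in> {0..<p}"
  shows "frag_of (x, a) - normal_form (\<lambda>k. \<xi> x k * a) \<in> T"
  using assms(1)
proof (induction rule: basis_induct)
  case zero
  have "frag_of (\<zero>, a) \<in> T" using T_closed(2)[OF relator_add_left[of \<zero> \<zero> a]] a by simp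
  moreover have "normal_form (\<lambda>k. \<xi> \<zero> k * a) \<in> T"
    using normal_form_zero normal_form_cong[of "\<lambda>k. \<xi> \<zero> k * a" "\<lambda>_. 0"] by (simp add: coord_zero)
  ultimately show ?case by (rule T_closed)
next
  case (basis i)
  \<comment> \<open>Off the diagonal the generators \<open>(e k, 0)\<close> remain; they are nonzero
    in the free group but lie in \<open>T\<close>.\<close>
  have "normal_form (\<lambda>k. \<xi> (e i) k * a) - frag_of (e i, a)
      = (\<Sum>k<n. frag_of (e k, (\<xi> (e i) k * a) mod p) - (if k = i then frag_of (e i, a) else 0))"
    using basis by (simp add: normal_form_def sum_subtractf)
  also have "\<dots> \<in> T"
    using basis a by (intro T_sum) (auto simp: coord_basis frag_zero_right basis_closed T_closed)
  finally show ?case using T_closed(2) by fastforce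
next
  case (neg x)
  have "frag_of (\<zero>, a) \<in> T" using T_closed(2)[OF relator_add_left[of \<zero> \<zero> a]] a by simp
  \<comment> \<open>Additivity for \<open>\<ominus> x \<oplus> x = \<zero>\<close> leaves only the
    generator \<open>(\<zero>, a)\<close>, which is in \<open>T\<close>.\<close>
  then have 1: "frag_of (\<ominus> x, a) + frag_of (x, a) \<in> T"
    using T_closed(4)[OF _ relator_add_left[of "\<ominus> x" x a]] neg(1) a by (fastforce simp: l_neg algebra_simps)
  have "normal_form (\<lambda>k. \<xi> (\<ominus> x) k * a) = normal_form (\<lambda>k. 0 - \<xi> x k * a)"
    by (rule normal_form_cong) (simp add: coord_neg neg)
  then have 2: "normal_form (\<lambda>k. \<xi> (\<ominus> x) k * a) + normal_form (\<lambda>k. \<xi> x k * a) \<in> T"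
    using T_closed(1)[OF normal_form_diff[of "\<lambda>_. 0" "\<lambda>k. \<xi> x k * a"] normal_form_zero] by (simp add: algebra_simps)
  show ?case
    using T_closed(4)[OF T_closed(4)[OF 1 2] neg(2)] by (simp add: algebra_simps)
next
  case (add x y)
  have "normal_form (\<lambda>k. \<xi> (x \<oplus> y) k * a) = normal_form (\<lambda>k. \<xi> x k * a + \<xi> y k * a)"
    by (rule normal_form_cong) (simp add: coord_add add distrib_right)
  then show ?case
    using T_closed(4)[OF T_closed(1)[OF relator_add_left[OF add(1,2) a] T_closed(1)[OF add(3,4)]]
        normal_form_add[of "\<lambda>k. \<xi> x k * a" "\<lambda>k. \<xi> y k * a"]]
    by (simp add: algebra_simps)
qed

lemma reduce_to_normal_form:
  assumes "f \<in> carrier F"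
  shows "f - normal_form (\<lambda>k. tensor_coord k f) \<in> T"
proof -
  from assms have "Poly_Mapping.keys f \<subseteq> tensor_support" by (simp add: carrier_F)
  then show ?thesis
  proof (induction rule: frag_induction)
    case zero
    show ?case using T_closed(2)[OF normal_form_zero] by (simp add: tensor_coord_simps)
  next
    case (one q)
    then show ?case using frag_of_normal_form by (cases q) (auto simp: tensor_coord_simps)
  next
    case (diff f g)
    then show ?case
      using T_closed(4)[OF T_closed(4)[OF diff] normal_form_diff[of "\<lambda>k. tensor_coord k f" "\<lambda>k. tensor_coord k g"]]
      by (simp add: tensor_coord_simps algebra_simps)
  qed
qed

text \<open>The relations exhaust the kernel: if all coordinates vanish modulo \<open>p\<close>, the
  element is equivalent to the normal form of 0, which is in \<open>T\<close>. This identifies the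
  base change with coordinate space.\<close>

lemma T_eq: "T = {f \<in> carrier F. \<forall>k<n. [tensor_coord k f = 0] (mod p)}"
proof (intro equalityI subsetI CollectI conjI allI impI)
  fix f assume "f \<in> {f \<in> carrier F. \<forall>k<n. [tensor_coord k f = 0] (mod p)}"
  then have f: "f \<in> carrier F" and 0: "\<And>k. k < n \<Longrightarrow> [tensor_coord k f = 0] (mod p)" by auto
  have "normal_form (\<lambda>k. tensor_coord k f) = normal_form (\<lambda>_. 0)" by (rule normal_form_cong) (rule 0)
  then show "f \<in> T" using T_closed(1)[OF reduce_to_normal_form[OF f] normal_form_zero] by simp
qed (auto simp: T_coord_zero T_closed)

text \<open>These are the cosets of \<open>T\<close>, each named by its vector of residues.\<close>

definition fibre :: "(nat \<Rightarrow> int) \<Rightarrow> ('a \<times> int \<Rightarrow>\<^sub>0 int) set"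
  where "fibre v = {f \<in> carrier F. tensor_coords f = v}"

lemma F_closed: "f \<in> carrier F \<Longrightarrow> g \<in> carrier F \<Longrightarrow> f + g \<in> carrier F"
  "f \<in> carrier F \<Longrightarrow> g \<in> carrier F \<Longrightarrow> f - g \<in> carrier F"
  using Poly_Mapping.keys_add[of f g] keys_diff[of f g] by (auto simp: carrier_F)

lemma coset_eq_fibre:
  assumes f: "f \<in> carrier F"
  shows "T #>\<^bsub>F\<^esub> f = fibre (tensor_coords f)"
proof (intro equalityI subsetI)
  fix g assume "g \<in> T #>\<^bsub>F\<^esub> f"
  then obtain t where t: "t \<in> T" "g = t + f" by (auto simp: r_coset_def F_eq)
  have "[tensor_coord k g = tensor_coord k f] (mod p)" if "k < n" for k
    using cong_add[OF T_coord_zero[OF t(1) that] cong_refl[of "tensor_coord k f"]] by (simp add: t tensor_coord_simps)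
  then show "g \<in> fibre (tensor_coords f)"
    using t f T_closed(5) by (simp add: fibre_def tensor_coords_def reduce_eq_iff F_closed)
next
  fix g assume g: "g \<in> fibre (tensor_coords f)"
  then have "g - f \<in> T"
    using f by (auto simp: T_eq fibre_def F_closed tensor_coords_def reduce_eq_iff tensor_coord_simps
        cong_iff_dvd_diff)
  then show "g \<in> T #>\<^bsub>F\<^esub> f" by (force simp: r_coset_def F_eq)
qed

lemma normal_form_closed: "normal_form w \<in> carrier F"
proof -
  have "frag_of (e i, w i mod p) \<in> carrier F" if "i < n" for i
    using basis_closed[OF that] p_gt_1 by (simp add: carrier_F)
  have "0 \<in> carrier F" by (simp add: carrier_F)
  have "(\<Sum>i\<in>I. frag_of (e i, w i mod p)) \<in> carrier F" if "I \<subseteq> {..<n}" for I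
  proof -
    have "finite I" using that finite_subset by blast
    then show ?thesis using that
      by (induction I rule: finite_induct)
        (simp_all add: F_closed \<open>\<And>i. i < n \<Longrightarrow> _\<close> \<open>0 \<in> carrier F\<close>)
  qed
  then show ?thesis unfolding normal_form_def by blast
qed

lemma tensor_coords_normal_form:
  assumes v: "v \<in> vectors"
  shows "tensor_coords (normal_form v) = v"
proof -
  have "tensor_coord k (normal_form v) = v k mod p" if "k < n" for k
  proof -
    have "tensor_coord k (normal_form v) = (\<Sum>i<n. \<xi> (e i) k * (v i mod p))"
      by (simp add: tensor_coord_def normal_form_def frag_eval_sum)
    also have "\<dots> = (\<Sum>i<n. if i = k then v i mod p else 0)"
      using that by (intro sum.cong) (auto simp: coord_basis)
    finally show ?thesis using that by simp
  qed
  then have "tensor_coords (normal_form v) = reduce v"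
    by (simp add: tensor_coords_def reduce_eq_iff cong_iff_mod_eq)
  then show ?thesis using v by (simp add: reduce_vector)
qed

lemma fibre_nonempty:
  assumes "v \<in> vectors"
  obtains f where "f \<in> fibre v"
  using tensor_coords_normal_form[OF assms] normal_form_closed[of v] that by (simp add: fibre_def)

lemma tensor_coords_in_vectors [simp]: "tensor_coords f \<in> vectors"
  by (simp add: tensor_coords_def)

lemma inj_fibre: "inj_on fibre vectors"
proof (rule inj_onI)
  fix u v assume "u \<in> vectors" and eq: "fibre u = fibre v"
  then obtain f where "f \<in> fibre u" by (blast elim: fibre_nonempty)
  with eq show "u = v" by (auto simp: fibre_def)
qed

section \<open>The operations of the base change in coordinates\<close>

abbreviation "A \<equiv> base_change L K"

lemma carrier_A: "carrier A = fibre ` vectors"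
proof -
  have "carrier A = (\<lambda>f. fibre (tensor_coords f)) ` carrier F"
    by (auto simp: base_change_def RCOSETS_def coset_eq_fibre)
  also have "\<dots> = fibre ` vectors"
  proof (intro equalityI subsetI)
    fix B assume "B \<in> fibre ` vectors"
    then obtain v where v: "v \<in> vectors" "B = fibre v" by auto
    then show "B \<in> (\<lambda>f. fibre (tensor_coords f)) ` carrier F"
      using tensor_coords_normal_form[OF v(1)] normal_form_closed[of v] by (auto intro!: image_eqI)
  qed auto
  finally show ?thesis .
qed

lemma zero_A: "\<zero>\<^bsub>A\<^esub> = fibre (reduce (\<lambda>_. 0))"
  by (auto simp: base_change_def T_eq fibre_def tensor_coords_def reduce_eq_iff)

lemma add_A:
  assumes u: "u \<in> vectors" and v: "v \<in> vectors"
  shows "fibre u \<oplus>\<^bsub>A\<^esub> fibre v = fibre (reduce (\<lambda>i. u i + v i))"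
proof (intro equalityI subsetI)
  have add: "f + g \<in> fibre (reduce (\<lambda>i. u i + v i))" if "f \<in> fibre u" "g \<in> fibre v" for f g
    using that by (auto simp: fibre_def F_closed tensor_coords_def tensor_coord_simps reduce_eq_iff
        cong_iff_mod_eq) (simp add: reduce_def mod_simps)
  {
    fix h assume "h \<in> fibre u \<oplus>\<^bsub>A\<^esub> fibre v"
    then show "h \<in> fibre (reduce (\<lambda>i. u i + v i))"
      using add by (auto simp: base_change_def set_mult_def F_eq)
  }
  fix h assume h: "h \<in> fibre (reduce (\<lambda>i. u i + v i))"
  \<comment> \<open>Any element \<open>f\<close> of the first fibre will do: coordinates are
    additive, so \<open>h - f\<close> lands in the second.\<close>
  obtain f where f: "f \<in> fibre u" using u by (rule fibre_nonempty)
  have "h - f \<in> carrier F" using f h by (simp add: fibre_def F_closed)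
  moreover have "tensor_coords (h - f) = v"
  proof (rule vectors_eqI)
    fix i assume i: "i < n"
    have "[tensor_coord i h = u i + v i] (mod p)"
      using h i by (auto simp: fibre_def tensor_coords_def reduce_eq_iff)
    moreover have "[tensor_coord i f = u i] (mod p)"
      using f reduce_cong[OF i, of "\<lambda>k. tensor_coord k f"] by (auto simp: fibre_def tensor_coords_def cong_sym)
    ultimately have "[tensor_coord i (h - f) = v i] (mod p)"
      using cong_diff[of "tensor_coord i h" "u i + v i" p "tensor_coord i f" "u i"] by (simp add: tensor_coord_simps)
    then show "[tensor_coords (h - f) i = v i] (mod p)"
      using reduce_cong[OF i] cong_trans unfolding tensor_coords_def by blast
  qed (use v in auto)
  ultimately have "h - f \<in> fibre v" by (simp add: fibre_def)
  then show "h \<in> fibre u \<oplus>\<^bsub>A\<^esub> fibre v"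
    using f by (force simp: base_change_def set_mult_def F_eq)
qed

lemma smult_A:
  assumes r: "r \<in> {0..<p}" and v: "v \<in> vectors"
  shows "r \<odot>\<^bsub>A\<^esub> fibre v = fibre (reduce (\<lambda>i. r * v i))"
proof -
  have "T #>\<^bsub>F\<^esub> tensor_scale K r f = fibre (reduce (\<lambda>i. r * v i))" if f: "f \<in> fibre v" for f
  proof -
    have keys: "Poly_Mapping.keys f \<subseteq> tensor_support" using f by (simp add: fibre_def carrier_F)
    then have closed: "tensor_scale K r f \<in> carrier F"
      using p_gt_1 unfolding carrier_F tensor_scale_def
      by (intro order.trans[OF keys_frag_extend]) (auto simp: K_simps)
    have "[tensor_coord k (tensor_scale K r f) = r * tensor_coord k f] (mod p)" for k
    proof -
      have "tensor_coord k (tensor_scale K r f) = frag_eval (\<lambda>(x, a). \<xi> x k * (r * a mod p)) f"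
        by (simp add: tensor_coord_def tensor_scale_def frag_eval_frag_extend K_simps case_prod_unfold)
      also have "[\<dots> = frag_eval (\<lambda>(x, a). r * (\<xi> x k * a)) f] (mod p)"
        by (intro frag_eval_cong) (auto simp: cong_iff_mod_eq mod_simps mult_ac)
      also have "frag_eval (\<lambda>(x, a). r * (\<xi> x k * a)) f = r * tensor_coord k f"
        by (simp add: tensor_coord_def frag_eval_def case_prod_unfold sum_distrib_left mult_ac)
      finally show ?thesis .
    qed
    moreover have "[r * tensor_coord k f = r * v k] (mod p)" if "k < n" for k
      using f reduce_cong[OF that, of "\<lambda>k. tensor_coord k f"]
      by (intro cong_mult cong_refl) (auto simp: fibre_def tensor_coords_def cong_sym)
    ultimately have "tensor_coords (tensor_scale K r f) = reduce (\<lambda>i. r * v i)"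
      unfolding tensor_coords_def reduce_eq_iff by (metis cong_trans)
    then show ?thesis using closed by (simp add: coset_eq_fibre)
  qed
  \<comment> \<open>A representative must exist, as otherwise the union over representatives would
    be empty.\<close>
  moreover obtain f where "f \<in> fibre v" using v by (rule fibre_nonempty)
  ultimately show ?thesis by (auto simp: base_change_def)
qed

text \<open>The coordinate functional is pushed through both extensions; expanding the bracket in
  structure constants separates the two arguments, and each evaluates to its own coordinate.\<close>

lemma bracket_A:
  assumes u: "u \<in> vectors" and v: "v \<in> vectors"
  shows "fibre u \<otimes>\<^bsub>A\<^esub> fibre v = fibre (coord_bracket structure_const u v)"
proof -
  have "T #>\<^bsub>F\<^esub> tensor_bracket L K f g = fibre (coord_bracket structure_const u v)"
    if f: "f \<in> fibre u" and g: "g \<in> fibre v" for f g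
  proof -
    have keys: "Poly_Mapping.keys f \<subseteq> tensor_support" "Poly_Mapping.keys g \<subseteq> tensor_support"
      using f g by (auto simp: fibre_def carrier_F)
    have closed: "tensor_bracket L K f g \<in> carrier F"
      unfolding carrier_F tensor_bracket_def
    proof (intro order.trans[OF keys_frag_extend] UN_least)
      fix q assume q: "q \<in> Poly_Mapping.keys f"
      show "Poly_Mapping.keys (case q of (x, a) \<Rightarrow> frag_extend (\<lambda>(y, b). frag_of (x \<otimes> y, a \<otimes>\<^bsub>K\<^esub> b)) g)
          \<subseteq> tensor_support"
        using q keys p_gt_1 unfolding case_prod_beta
        by (intro order.trans[OF keys_frag_extend] UN_least) (auto simp: K_simps intro!: bracket_closed)
    qed
    have 1: "[tensor_coord k (tensor_bracket L K f g)
        = (\<Sum>i<n. \<Sum>j<n. tensor_coord i f * tensor_coord j g * structure_const i j k)] (mod p)" if k: "k < n" for k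
    proof -
      have "tensor_coord k (tensor_bracket L K f g)
          = frag_eval (\<lambda>q. frag_eval (\<lambda>r. \<xi> (fst q \<otimes> fst r) k * (snd q * snd r mod p)) g) f"
        by (simp add: tensor_coord_def tensor_bracket_def frag_eval_frag_extend K_simps case_prod_unfold)
      also have "[\<dots> = frag_eval (\<lambda>q. frag_eval (\<lambda>r. \<Sum>i<n. \<Sum>j<n.
          (\<xi> (fst q) i * snd q) * (\<xi> (fst r) j * snd r) * structure_const i j k) g) f] (mod p)"
      proof (intro frag_eval_cong)
        fix q r assume "q \<in> Poly_Mapping.keys f" "r \<in> Poly_Mapping.keys g"
        then have "fst q \<in> carrier L" "fst r \<in> carrier L" using keys by auto
        then have eq: "\<xi> (fst q \<otimes> fst r) k * (snd q * snd r) = (\<Sum>i<n. \<Sum>j<n.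
            (\<xi> (fst q) i * snd q) * (\<xi> (fst r) j * snd r) * structure_const i j k)"
          by (simp add: coord_bracket_expand[OF _ _ k] sum_distrib_left sum_distrib_right mult_ac)
        show "[\<xi> (fst q \<otimes> fst r) k * (snd q * snd r mod p) = (\<Sum>i<n. \<Sum>j<n.
            (\<xi> (fst q) i * snd q) * (\<xi> (fst r) j * snd r) * structure_const i j k)] (mod p)"
          unfolding eq[symmetric] by (simp add: cong_iff_mod_eq mod_mult_right_eq)
      qed
      also have "frag_eval (\<lambda>q. frag_eval (\<lambda>r. \<Sum>i<n. \<Sum>j<n.
          (\<xi> (fst q) i * snd q) * (\<xi> (fst r) j * snd r) * structure_const i j k) g) f
          = (\<Sum>i<n. \<Sum>j<n. tensor_coord i f * tensor_coord j g * structure_const i j k)"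
      proof -
        \<comment> \<open>Evaluation is also linear in the weight, so the double evaluation of a
          product of weights factors.\<close>
        have swap: "frag_eval (\<lambda>q. \<Sum>i\<in>I. w i q) h = (\<Sum>i\<in>I. frag_eval (w i) h)" for I :: "nat set" and w and h :: "'a \<times> int \<Rightarrow>\<^sub>0 int"
          unfolding frag_eval_def sum_distrib_left by (rule sum.swap)
        have left: "frag_eval (\<lambda>q. r * w q) h = r * frag_eval w h" for r w and h :: "'a \<times> int \<Rightarrow>\<^sub>0 int"
          by (simp add: frag_eval_def sum_distrib_left mult_ac)
        have "frag_eval (\<lambda>q. frag_eval (\<lambda>r. s q * t r * c) g) f = frag_eval s f * frag_eval t g * c" for s t c
        proof -
          have "frag_eval (\<lambda>r. s q * t r * c) g = (c * frag_eval t g) * s q" for q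
            using left[of "s q * c" t g] by (simp add: mult_ac)
          then show ?thesis using left[of "c * frag_eval t g" s f] by (simp add: mult_ac)
        qed
        then show ?thesis unfolding swap by (simp add: tensor_coord_def case_prod_unfold)
      qed
      finally show ?thesis .
    qed
    have "[tensor_coord i f = u i] (mod p)" "[tensor_coord i g = v i] (mod p)" if "i < n" for i
      using f g reduce_cong[OF that, of "\<lambda>k. tensor_coord k f"] reduce_cong[OF that, of "\<lambda>k. tensor_coord k g"]
      by (auto simp: fibre_def tensor_coords_def cong_sym)
    then have 2: "[(\<Sum>i<n. \<Sum>j<n. tensor_coord i f * tensor_coord j g * structure_const i j k)
        = (\<Sum>i<n. \<Sum>j<n. u i * v j * structure_const i j k)] (mod p)" for k
      by (intro cong_sum cong_mult cong_refl) auto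
    have "tensor_coords (tensor_bracket L K f g) = coord_bracket structure_const u v"
      unfolding tensor_coords_def coord_bracket_def reduce_eq_iff
      by (intro allI impI cong_trans[OF 1 2])
    then show ?thesis using closed by (simp add: coset_eq_fibre)
  qed
  moreover obtain f where "f \<in> fibre u" using u by (rule fibre_nonempty)
  moreover obtain g where "g \<in> fibre v" using v by (rule fibre_nonempty)
  ultimately show ?thesis by (auto simp: base_change_def)
qed

end


section \<open>Counting subalgebras and ideals of the base change\<close>


text \<open>Coefficients with respect to a basis are a bijection. This lets dimensions be read off
  from cardinalities.\<close>

lemma (in vectorspace) card_carrier_eq:
  assumes K: "finite (carrier K)" and V: "finite (carrier V)"
  shows "card (carrier V) = card (carrier K) ^ dim"
proof -
  \<comment> \<open>The finite carrier is its own finite generating set, which gives finite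
    dimension.\<close>
  have "gen_set (carrier V)"
    using span_mem[of "carrier V"] span_closed[of "carrier V"] by blast
  then have "fin_dim" using V by (auto simp: fin_dim_def)
  then obtain B where B: "finite B" "basis B" using finite_basis_exists by blast
  then have BV: "B \<subseteq> carrier V" by (simp add: basis_def)
  have ex1: "\<exists>!a. a \<in> B \<rightarrow>\<^sub>E carrier K \<and> lincomb a B = v" if "v \<in> carrier V" for v
    using basis_criterion[OF B(1) BV] B(2) that by blast
  have closed: "lincomb a B \<in> carrier V" if "a \<in> B \<rightarrow>\<^sub>E carrier K" for a
    using BV that by (intro lincomb_closed) (auto simp: PiE_iff)
  have "bij_betw (\<lambda>a. lincomb a B) (B \<rightarrow>\<^sub>E carrier K) (carrier V)"
  proof (rule bij_betw_imageI)
    show "inj_on (\<lambda>a. lincomb a B) (B \<rightarrow>\<^sub>E carrier K)"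
      using ex1 closed by (intro inj_onI) metis
    show "(\<lambda>a. lincomb a B) ` (B \<rightarrow>\<^sub>E carrier K) = carrier V"
      using ex1 closed by (auto simp: image_iff) metis
  qed
  then have "card (carrier V) = card (B \<rightarrow>\<^sub>E carrier K)" by (simp add: bij_betw_same_card)
  also have "\<dots> = card (carrier K) ^ dim" using B by (simp add: card_PiE dim_basis)
  finally show ?thesis .
qed

lemma field_residue_ring:
  assumes "Factorial_Ring.prime p"
  shows "field (residue_ring p)"
proof -
  have "p > 1" using assms by (simp add: prime_gt_1_int)
  then have p: "int (nat p) = p" by simp
  have "Factorial_Ring.prime (nat p)" using assms by simp
  then have "residues_prime (nat p)" by (rule residues_prime.intro)
  then show ?thesis using residues_prime.is_field p by fastforce
qed

section \<open>Vector space structure, dimension and counting on the base change\<close>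

context tensor_coordinates
begin

lemma vectorspace_A: "vectorspace K A"
proof (rule vs_criteria[OF field_residue_ring[OF prime_p]])
  have fib: "v \<in> carrier A \<longleftrightarrow> (\<exists>u\<in>vectors. v = fibre u)" for v by (auto simp: carrier_A)
  have red: "reduce f \<in> vectors" for f by simp
  have red_eq: "fibre (reduce f) = fibre (reduce g)" if "\<And>i. i < n \<Longrightarrow> f i mod p = g i mod p" for f g
    using that by (metis cong_iff_mod_eq reduce_eq_iff)
  have r: "reduce f i = f i mod p" if "i < n" for f i using that by (simp add: reduce_def)
  note ops = fib zero_A add_A smult_A K_simps
  show "\<zero>\<^bsub>A\<^esub> \<in> carrier A" by (auto simp: ops)
  show "\<forall>v w. v \<in> carrier A \<and> w \<in> carrier A \<longrightarrow> v \<oplus>\<^bsub>A\<^esub> w \<in> carrier A"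
    by (auto simp: ops)
  show "\<forall>v\<in>carrier A. \<exists>w\<in>carrier A. v \<oplus>\<^bsub>A\<^esub> w = \<zero>\<^bsub>A\<^esub>"
  proof
    fix v assume "v \<in> carrier A"
    then obtain u where u: "u \<in> vectors" "v = fibre u" by (auto simp: fib)
    have "v \<oplus>\<^bsub>A\<^esub> fibre (reduce (\<lambda>i. - u i)) = \<zero>\<^bsub>A\<^esub>"
      unfolding u(2) zero_A by (simp add: add_A u(1)) (rule red_eq, simp add: r mod_simps)
    then show "\<exists>w\<in>carrier A. v \<oplus>\<^bsub>A\<^esub> w = \<zero>\<^bsub>A\<^esub>" by (intro bexI[of _ "fibre (reduce (\<lambda>i. - u i))"]) (auto simp: fib)
  qed
  show "\<forall>c v. c \<in> carrier K \<and> v \<in> carrier A \<longrightarrow> c \<odot>\<^bsub>A\<^esub> v \<in> carrier A"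
    by (auto simp: ops)
  show "\<forall>v w. v \<in> carrier A \<and> w \<in> carrier A \<longrightarrow> v \<oplus>\<^bsub>A\<^esub> w = w \<oplus>\<^bsub>A\<^esub> v"
    by (auto simp: ops add.commute)
  show "\<forall>v w x. v \<in> carrier A \<and> w \<in> carrier A \<and> x \<in> carrier A \<longrightarrow> v \<oplus>\<^bsub>A\<^esub> w \<oplus>\<^bsub>A\<^esub> x = v \<oplus>\<^bsub>A\<^esub> (w \<oplus>\<^bsub>A\<^esub> x)"
    by (clarsimp simp: ops) (rule red_eq, simp add: r mod_simps add.assoc)
  show "\<forall>v\<in>carrier A. v \<oplus>\<^bsub>A\<^esub> \<zero>\<^bsub>A\<^esub> = v"
  proof
    fix v assume "v \<in> carrier A"
    then obtain u where u: "u \<in> vectors" "v = fibre (reduce u)" by (auto simp: fib) (metis reduce_vector)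
    show "v \<oplus>\<^bsub>A\<^esub> \<zero>\<^bsub>A\<^esub> = v" unfolding u(2) zero_A add_A[OF red red] by (rule red_eq) (simp add: r mod_simps)
  qed
  show "\<forall>a b v. a \<in> carrier K \<and> b \<in> carrier K \<and> v \<in> carrier A \<longrightarrow> (a \<otimes>\<^bsub>K\<^esub> b) \<odot>\<^bsub>A\<^esub> v = a \<odot>\<^bsub>A\<^esub> (b \<odot>\<^bsub>A\<^esub> v)"
    using p_gt_1 by (clarsimp simp: ops) (rule red_eq, simp add: r mod_simps mult.assoc)
  show "\<forall>v\<in>carrier A. \<one>\<^bsub>K\<^esub> \<odot>\<^bsub>A\<^esub> v = v"
    using p_gt_1 by (auto simp: ops reduce_vector)
  show "\<forall>a b v. a \<in> carrier K \<and> b \<in> carrier K \<and> v \<in> carrier A \<longrightarrow>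
      (a \<oplus>\<^bsub>K\<^esub> b) \<odot>\<^bsub>A\<^esub> v = a \<odot>\<^bsub>A\<^esub> v \<oplus>\<^bsub>A\<^esub> b \<odot>\<^bsub>A\<^esub> v"
    using p_gt_1 by (clarsimp simp: ops) (rule red_eq, simp add: r mod_simps distrib_right)
  show "\<forall>a v w. a \<in> carrier K \<and> v \<in> carrier A \<and> w \<in> carrier A \<longrightarrow>
      a \<odot>\<^bsub>A\<^esub> (v \<oplus>\<^bsub>A\<^esub> w) = a \<odot>\<^bsub>A\<^esub> v \<oplus>\<^bsub>A\<^esub> a \<odot>\<^bsub>A\<^esub> w"
    by (clarsimp simp: ops) (rule red_eq, simp add: r mod_simps distrib_left)
qed

lemma finite_A: "finite (carrier A)" "card (carrier A) = nat p ^ n"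
  by (simp_all add: carrier_A card_image inj_fibre card_vectors)

lemma card_subspace_A:
  assumes "VectorSpace.subspace K H A"
  shows "card H = nat p ^ vectorspace.dim K (A\<lparr>carrier := H\<rparr>)"
proof -
  have vs: "vectorspace K (A\<lparr>carrier := H\<rparr>)"
    using vectorspace.subspace_is_vs[OF vectorspace_A assms] .
  have "H \<subseteq> carrier A" using assms by (simp add: VectorSpace.subspace_def submodule_def)
  then have "finite H" using finite_A finite_subset by blast
  then show ?thesis using vectorspace.card_carrier_eq[OF vs] by (simp add: K_simps)
qed

lemma dim_A: "vectorspace.dim K A = n"
proof -
  have "nat p ^ n = nat p ^ vectorspace.dim K A"
    using vectorspace.card_carrier_eq[OF vectorspace_A] finite_A by (simp add: K_simps)
  then show ?thesis using p_gt_1 by (simp add: power_inject_exp)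
qed

lemma subspace_A_iff:
  assumes H: "H \<subseteq> vectors"
  shows "VectorSpace.subspace K (fibre ` H) A \<longleftrightarrow> subspace H"
proof -
  have mem: "fibre v \<in> fibre ` H \<longleftrightarrow> v \<in> H" if "v \<in> vectors" for v
    using inj_on_image_mem_iff[OF inj_fibre that H] .
  have HV: "v \<in> vectors" if "v \<in> H" for v using that H by blast
  have "module K A" using vectorspace_A by (simp add: vectorspace_def)
  then have "VectorSpace.subspace K (fibre ` H) A \<longleftrightarrow> submodule K (fibre ` H) A"
    by (simp add: VectorSpace.subspace_def vectorspace_A)
  also have "\<dots> \<longleftrightarrow> fibre ` H \<subseteq> carrier A \<and>
      (\<forall>v\<in>H. \<forall>w\<in>H. fibre v \<oplus>\<^bsub>A\<^esub> fibre w \<in> fibre ` H) \<and> \<zero>\<^bsub>A\<^esub> \<in> fibre ` H \<and>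
      (\<forall>c\<in>carrier K. \<forall>v\<in>H. c \<odot>\<^bsub>A\<^esub> fibre v \<in> fibre ` H)"
    using \<open>module K A\<close> by (auto simp: submodule_def)
  also have "\<dots> \<longleftrightarrow> subspace H"
    using H by (auto simp: subspace_def carrier_A zero_A add_A smult_A K_simps mem HV)
  finally show ?thesis .
qed

lemma counted_by_A_iff:
  assumes H: "H \<subseteq> vectors"
  shows "counted_by star K A (fibre ` H) \<longleftrightarrow> coord_counted structure_const star H"
proof -
  have mem: "fibre v \<in> fibre ` H \<longleftrightarrow> v \<in> H" if "v \<in> vectors" for v
    using inj_on_image_mem_iff[OF inj_fibre that H] .
  have HV: "v \<in> vectors" if "v \<in> H" for v using that H by blast
  have "coord_bracket structure_const u v \<in> vectors" for u v by (simp add: coord_bracket_def)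
  then show ?thesis
    by (cases star)
      (auto simp: lie_subalgebra_def lie_ideal_def subspace_A_iff[OF H] carrier_A bracket_A mem HV)
qed

text \<open>For \<open>d \<le> n\<close>, codimension \<open>d\<close> means having
  \<open>p ^ (n - d)\<close> elements; for larger \<open>d\<close> both sides are 0. Writing
  \<open>card S + d = n\<close> avoids truncated subtraction.\<close>

lemma codim_count_A:
  "codim_count star K A d = (\<Sum>S | S \<subseteq> {..<n} \<and> card S + d = n.
    card (variety_points K (echelon_variety star n structure_const S)))"
proof (cases "d \<le> n")
  case True
  have "bij_betw (\<lambda>H. fibre ` H) {H. coord_counted structure_const star H \<and> card H = nat p ^ (n - d)}
    {H. counted_by star K A H \<and> has_codim K A H d}"
  proof (rule bij_betw_imageI)
    have sub: "H \<subseteq> vectors" if "coord_counted structure_const star H" for H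
      using coord_counted_subspace[OF that] by (simp add: subspace_def)
    have codim: "has_codim K A (fibre ` H) d \<longleftrightarrow> card H = nat p ^ (n - d)"
      if "VectorSpace.subspace K (fibre ` H) A" "H \<subseteq> vectors" for H
    proof -
      have "card (fibre ` H) = card H" using inj_fibre that(2) by (meson card_image inj_on_subset)
      then have "card H = nat p ^ vectorspace.dim K (A\<lparr>carrier := fibre ` H\<rparr>)"
        using card_subspace_A[OF that(1)] by simp
      then show ?thesis using True p_gt_1 by (auto simp: has_codim_def dim_A power_inject_exp)
    qed
    have counted_subspace: "VectorSpace.subspace K H A" if "counted_by star K A H" for H
      using that by (cases star) (auto simp: lie_subalgebra_def lie_ideal_def)
    show "inj_on (\<lambda>H. fibre ` H) {H. coord_counted structure_const star H \<and> card H = nat p ^ (n - d)}"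
    proof (rule inj_onI)
      fix H H' assume "H \<in> {H. coord_counted structure_const star H \<and> card H = nat p ^ (n - d)}"
        and "H' \<in> {H. coord_counted structure_const star H \<and> card H = nat p ^ (n - d)}"
        and "fibre ` H = fibre ` H'"
      then show "H = H'" using inj_on_image_eq_iff[OF inj_fibre sub sub, of H H'] by simp
    qed
    show "(\<lambda>H. fibre ` H) ` {H. coord_counted structure_const star H \<and> card H = nat p ^ (n - d)}
      = {H. counted_by star K A H \<and> has_codim K A H d}"
    proof (intro equalityI subsetI)
      fix B assume B: "B \<in> {H. counted_by star K A H \<and> has_codim K A H d}"
      then have "B \<subseteq> fibre ` vectors"
        using counted_subspace[of B] by (auto simp: VectorSpace.subspace_def submodule_def carrier_A)
      then obtain H where H: "H \<subseteq> vectors" "B = fibre ` H" by (auto simp: subset_image_iff)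
      then show "B \<in> (\<lambda>H. fibre ` H) ` {H. coord_counted structure_const star H \<and> card H = nat p ^ (n - d)}"
        using B codim counted_subspace by (auto simp: counted_by_A_iff)
    next
      fix B assume "B \<in> (\<lambda>H. fibre ` H) ` {H. coord_counted structure_const star H \<and> card H = nat p ^ (n - d)}"
      then show "B \<in> {H. counted_by star K A H \<and> has_codim K A H d}"
        using sub codim counted_subspace by (auto simp: counted_by_A_iff)
    qed
  qed
  moreover have "{S. S \<subseteq> {..<n} \<and> card S = n - d} = {S. S \<subseteq> {..<n} \<and> card S + d = n}"
    using True by auto
  ultimately show ?thesis
    by (simp add: codim_count_def card_coord_counted bij_betw_same_card[symmetric])
next
  case False
  then show ?thesis by (simp add: codim_count_def has_codim_def dim_A)
qed

end

section \<open>The zeta function\<close>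

lemma eval_XY_monom: "eval_XY (Polynomial.monom 1 d) x y = y ^ d"
  by (simp add: eval_XY_def map_poly_monom poly_monom)

text \<open>The basis is the preimage of the unit vectors under the isomorphism, whose components
  serve as dual coordinates.\<close>

lemma based_lie_ring_exists:
  fixes L :: "('a, 'm) ring_scheme" and n :: nat
  assumes "lie_ring L"
    and "add_monoid L \<cong> product_group {..<n} (\<lambda>_. integer_group)"
  obtains e \<xi> where "based_lie_ring L n e \<xi>"
proof -
  interpret lie_ring L by fact
  let ?Z = "product_group {..<n} (\<lambda>_. integer_group)"
  obtain \<xi> where \<xi>: "\<xi> \<in> iso (add_monoid L) ?Z" using assms(2) by (auto simp: is_iso_def)
  then have hom: "\<xi> \<in> hom (add_monoid L) ?Z" and bij: "bij_betw \<xi> (carrier L) (carrier ?Z)"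
    by (auto simp: iso_def)
  have add: "\<xi> (x \<oplus>\<^bsub>L\<^esub> y) i = \<xi> x i + \<xi> y i" if "x \<in> carrier L" "y \<in> carrier L" "i < n" for x y i
    using hom_mult[OF hom, of x y] that by simp
  have ext: "\<xi> x \<in> extensional {..<n}" if "x \<in> carrier L" for x
    using bij that by (auto simp: bij_betw_def PiE_iff)
  have eqI: "x = y" if "x \<in> carrier L" "y \<in> carrier L" "\<And>i. i < n \<Longrightarrow> \<xi> x i = \<xi> y i" for x y
    using that bij extensionalityI[OF ext ext, of x y] by (auto simp: bij_betw_def dest: inj_onD)
  define unit where "unit j = (\<lambda>i\<in>{..<n}. of_bool (j = i) :: int)" for j
  define e where "e = (\<lambda>j. inv_into (carrier L) \<xi> (unit j))"
  have "unit j \<in> carrier ?Z" for j by (auto simp: unit_def)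
  then have e: "e j \<in> carrier L" "\<xi> (e j) = unit j" for j
    using bij by (auto simp: e_def bij_betw_def inv_into_into f_inv_into_f)
  have zero: "\<xi> \<zero>\<^bsub>L\<^esub> i = 0" if "i < n" for i using add[of "\<zero>\<^bsub>L\<^esub>" "\<zero>\<^bsub>L\<^esub>"] that by simp
  let ?G = "generate (add_monoid L) (e ` {..<n})"
  have sub: "e ` {..<n} \<subseteq> carrier L" using e by auto
  have G: "subgroup ?G (add_monoid L)" by (rule add.generate_is_subgroup[OF sub])
  have neg: "\<xi> (\<ominus>\<^bsub>L\<^esub> x) i = - \<xi> x i" if "x \<in> carrier L" "i < n" for x i
    using add[of x "\<ominus>\<^bsub>L\<^esub> x" i] zero that by (simp add: r_neg)
  have pow: "\<xi> ([k] \<cdot>\<^bsub>L\<^esub> e j) i = k * unit j i" if "i < n" for k :: int and i j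
  proof -
    have nat: "\<xi> ([m] \<cdot>\<^bsub>L\<^esub> e j) i = int m * unit j i" for m :: nat
      using that by (induction m) (simp_all add: zero add e distrib_right)
    show ?thesis
    proof (cases "k \<ge> 0")
      case True
      then obtain m where "k = int m" by (metis nonneg_int_cases)
      then show ?thesis using nat[of m] add_pow_int_ge[of "int m" L "e j"] by simp
    next
      case False
      then have "[k] \<cdot>\<^bsub>L\<^esub> e j = \<ominus>\<^bsub>L\<^esub> ([nat (- k)] \<cdot>\<^bsub>L\<^esub> e j)" using add_pow_int_lt[of k L "e j"] by simp
      then show ?thesis using False by (simp add: neg nat e that)
    qed
  qed
  have pow_G: "[k] \<cdot>\<^bsub>L\<^esub> e j \<in> ?G" if "j < n" for k :: int and j
    using add.subgroup_int_pow_closed[OF G, of "e j" k] generate.incl[of "e j" "e ` {..<n}" "add_monoid L"] that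
    by simp
  \<comment> \<open>All coordinates from \<open>m\<close> on vanish. Subtracting a multiple of a
    basis element kills the last one that may be nonzero, and \<open>m = n\<close> is the general
    case.\<close>
  have "x \<in> ?G" if "m \<le> n" "x \<in> carrier L" "\<And>i. m \<le> i \<Longrightarrow> i < n \<Longrightarrow> \<xi> x i = 0" for m x
    using that
  proof (induction m arbitrary: x)
    case 0
    then have "x = \<zero>\<^bsub>L\<^esub>" by (intro eqI) (auto simp: zero)
    then show ?case using generate.one[of "add_monoid L"] by simp
  next
    case (Suc m)
    define y where "y = [\<xi> x m] \<cdot>\<^bsub>L\<^esub> e m"
    have y: "y \<in> ?G" "y \<in> carrier L" using pow_G[of m "\<xi> x m"] Suc.prems e by (auto simp: y_def)
    have "x \<ominus>\<^bsub>L\<^esub> y \<in> ?G"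
    proof (rule Suc.IH)
      fix i assume i: "m \<le> i" "i < n"
      have "\<xi> (x \<ominus>\<^bsub>L\<^esub> y) i = \<xi> x i - \<xi> y i"
        using add[of x "\<ominus>\<^bsub>L\<^esub> y" i] neg[of y i] y Suc.prems i by (simp add: a_minus_def)
      then show "\<xi> (x \<ominus>\<^bsub>L\<^esub> y) i = 0"
        using i Suc.prems by (cases "i = m") (auto simp: y_def pow unit_def)
    qed (use Suc.prems y in auto)
    then have "x \<ominus>\<^bsub>L\<^esub> y \<oplus>\<^bsub>L\<^esub> y \<in> ?G" using subgroup.m_closed[OF G _ y(1)] by simp
    moreover have "x \<ominus>\<^bsub>L\<^esub> y \<oplus>\<^bsub>L\<^esub> y = x" using Suc.prems y by (simp add: a_minus_def a_assoc l_neg)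
    ultimately show ?case by simp
  qed
  then have "carrier L \<subseteq> ?G" by (meson linorder_not_le order_refl subsetI)
  then have "?G = carrier L" using add.generate_incl[OF sub] by auto
  then have "based_lie_ring L n e \<xi>"
    using e add by unfold_locales (auto simp: unit_def)
  then show thesis using that by blast
qed

theorem theorem2p1:
  fixes L :: "('a, 'm) ring_scheme" and n :: nat and star :: zeta_kind
  assumes "lie_ring L"
    and "add_monoid L \<cong> product_group {..<n} (\<lambda>_. integer_group)"
  shows "\<exists>(h::nat) (U :: nat \<Rightarrow> variety) (W :: nat \<Rightarrow> int poly poly).
    (\<forall>j\<in>{1..h}. is_variety (U j)) \<and>
    finite {p::nat. Factorial_Ring.prime p \<and>
      \<not> (\<forall>s::complex. lie_zeta star L n p s =
            (\<Sum>j=1..h. of_nat (card (variety_points (prime_field p) (U j)))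
               * eval_XY (W j) (of_nat p) (of_nat p powr (- s))))}"
proof -
  obtain e \<xi> where "based_lie_ring L n e \<xi>" using assms by (rule based_lie_ring_exists)
  then interpret based_lie_ring L n e \<xi> .
  define h where "h = card (Pow {..<n})"
  obtain S where S: "bij_betw S {1..h} (Pow {..<n})"
    using ex_bij_betw_nat_finite_1[of "Pow {..<n}"] by (auto simp: h_def)
  define V where "V = echelon_variety star n structure_const"
  have "lie_zeta star L n p s = (\<Sum>j=1..h. of_nat (card (variety_points (prime_field p) (V (S j))))
      * eval_XY (Polynomial.monom 1 (n - card (S j))) (of_nat p) (of_nat p powr (- s)))"
    if "Factorial_Ring.prime p" for p :: nat and s :: complex
  proof -
    interpret tensor_coordinates L n e \<xi> "int p"
      using that by unfold_locales simp
    let ?t = "of_nat p powr (- s) :: complex"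
    let ?N = "\<lambda>S. of_nat (card (variety_points (prime_field p) (V S))) :: complex"
    have codim: "{T \<in> Pow {..<n}. card T + i = n} = {T. T \<subseteq> {..<n} \<and> card T + i = n}" for i by auto
    have "lie_zeta star L n p s = (\<Sum>i=0..n. \<Sum>T | T \<in> Pow {..<n} \<and> card T + i = n. ?N T * ?t ^ i)"
      by (simp add: lie_zeta_def codim_count_A V_def sum_distrib_right)
    \<comment> \<open>With the condition inside the summand the ranges are independent and the sums
      can be exchanged; each \<open>T\<close> then survives for exactly one
      \<open>i\<close>.\<close>
    also have "\<dots> = (\<Sum>i=0..n. \<Sum>T\<in>Pow {..<n}. if card T + i = n then ?N T * ?t ^ i else 0)"
      by (intro sum.cong refl sum.inter_filter) simp
    also have "\<dots> = (\<Sum>T\<in>Pow {..<n}. \<Sum>i=0..n. if card T + i = n then ?N T * ?t ^ i else 0)"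
      by (rule sum.swap)
    also have "\<dots> = (\<Sum>T\<in>Pow {..<n}. ?N T * ?t ^ (n - card T))"
    proof (rule sum.cong[OF refl])
      fix T assume "T \<in> Pow {..<n}"
      then have "card T \<le> n" using card_mono[of "{..<n}" T] by simp
      then have eq: "card T + i = n \<longleftrightarrow> i = n - card T" for i by auto
      show "(\<Sum>i=0..n. if card T + i = n then ?N T * ?t ^ i else 0) = ?N T * ?t ^ (n - card T)"
        unfolding eq by (subst sum.delta) simp_all
    qed
    also have "\<dots> = (\<Sum>j=1..h. ?N (S j) * ?t ^ (n - card (S j)))"
      by (rule sum.reindex_bij_betw[OF S, symmetric])
    finally show ?thesis by (simp add: eval_XY_monom)
  qed
  then have "{p::nat. Factorial_Ring.prime p \<and>
      \<not> (\<forall>s::complex. lie_zeta star L n p s =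
            (\<Sum>j=1..h. of_nat (card (variety_points (prime_field p) (V (S j))))
               * eval_XY (Polynomial.monom 1 (n - card (S j))) (of_nat p) (of_nat p powr (- s))))} = {}"
    by blast
  moreover have "is_variety (V (S j))" if "j \<in> {1..h}" for j
    using bij_betwE[OF S] that by (auto simp: V_def intro!: is_variety_echelon_variety)
  ultimately show ?thesis
    by (intro exI[of _ h] exI[of _ "\<lambda>j. V (S j)"] exI[of _ "\<lambda>j. Polynomial.monom 1 (n - card (S j))"])
      (metis finite.emptyI)
qed

end
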